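(* Let $i:Z\hookrightarrow X$ be a closed immersion with open complement $j:U\hookrightarrow X$, and assume the recollement axioms for $(i,j)$. Let $A\in\mathcal C(X)$ and let $c\in H^d(X;A)$ satisfy $j^*c=0$. Let $\delta:H^{d-1}(U;j^*A)\to H_Z^d(X;A)$ be the connecting morphism. (1) The set $\mathrm{Lift}_Z^d(c)$ is a nonempty torsor under $\mathrm{im}(\delta)$, and $\mathrm{Loc}_Z^{\mathrm{tor}}(c)$ is the corresponding torsor after transport by the adjunction isomorphism $H_Z^d(X;A)\cong\mathrm{Hom}_{\mathcal C(Z)}(\mathbf 1_Z,i^!A[d])$. (2) If $\mathrm{im}(\delta)=0$ (equivalently, $\ker(\mathrm{forg})=0$ in degree $d$), then the canonical localised class $\mathrm{Loc}_Z(c)$ exists. It is the unique morphism $\mathbf 1_Z\to i^!A[d]$ whose adjoint $\widetilde c:\mathbf 1_X\to i_*i^!A[d]$ satisfies $\epsilon_{A[d]}\circ\widetilde c=c$, where $\epsilon_{A[d]}:i_*i^!A[d]\to A[d]$ is the counit.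
   Context: Setting: to each space $X$ (in a fixed category of spaces with closed immersions, open complements, Cartesian squares and proper morphisms) is attached a stable triangulated category $\mathcal C(X)$ with a symmetric monoidal structure $(\otimes,\mathbf 1_X)$. Each morphism $f:X\to Y$ has exact functors $f^*\dashv f_*$, with $f^*$ symmetric monoidal, so $f^*\mathbf 1_Y\simeq\mathbf 1_X$. Recollement axioms for a closed immersion $i:Z\hookrightarrow X$ with open complement $j:U=X\setminus Z\hookrightarrow X$: adjunctions $i^*\dashv i_*\dashv i^!$ and $j_!\dashv j^*\dashv j_*$; $i_*$ and $j_!$ are fully faithful; $j^*i_*=0$ and $i^*j_!=0$; and for each $M\in\mathcal C(X)$ functorial distinguished triangles $j_!j^*M\to M\to i_*i^*M\xrightarrow{+1}$ and $i_*i^!M\to M\to j_*j^*M\xrightarrow{+1}$, whose maps to and from $M$ are the adjunction counits and units. Definitions: $H^d(X;A)=\mathrm{Hom}_{\mathcal C(X)}(\mathbf 1_X,A[d])$; $H_Z^d(X;A)=\mathrm{Hom}_{\mathcal C(X)}(\mathbf 1_X,i_*i^!A[d])$; $\mathrm{forg}:H_Z^d(X;A)\to H^d(X;A)$ is induced by the counit $i_*i^!A\to A$. Applying $\mathrm{Hom}(\mathbf 1_X,-)$ to $i_*i^!A\to A\to j_*j^*A\xrightarrow{+1}$, and using $\mathrm{Hom}(\mathbf 1_X,j_*j^*A[d])\cong H^d(U;j^*A)$, gives the localisation long exact sequence $\cdots\to H_Z^d(X;A)\xrightarrow{\mathrm{forg}}H^d(X;A)\xrightarrow{j^*}H^d(U;j^*A)\xrightarrow{\delta}H_Z^{d+1}(X;A)\to\cdots$.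 $\mathrm{Lift}_Z^d(c)=\{\widetilde c\in H_Z^d(X;A)\mid\mathrm{forg}(\widetilde c)=c\}$. $\mathrm{Loc}_Z^{\mathrm{tor}}(c)\subset\mathrm{Hom}_{\mathcal C(Z)}(\mathbf 1_Z,i^!A[d])$ is the set of adjoints (under $i_*\dashv i^!$, via the stated isomorphism, using $i^*\mathbf 1_X\simeq\mathbf 1_Z$ and $i^*\dashv i_*$) of elements of $\mathrm{Lift}_Z^d(c)$. If this set is a singleton, its unique element is the canonical localised class, denoted $\mathrm{Loc}_Z(c)$. *)

theory Defs
  imports "HOL-Algebra.Group_Action"
begin

section \<open>Categories, functors, adjunctions\<close>

record ('o, 'm) precat =
  Ob :: "'o set"
  Ar :: "'m set"
  Dom :: "'m \<Rightarrow> 'o"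
  Cod :: "'m \<Rightarrow> 'o"
  Id :: "'o \<Rightarrow> 'm"
  Comp :: "'m \<Rightarrow> 'm \<Rightarrow> 'm"  (infixl "\<cdot>\<index>" 70)

definition Hom :: "('o, 'm, 'z) precat_scheme \<Rightarrow> 'o \<Rightarrow> 'o \<Rightarrow> 'm set" where
  "Hom C A B = {f \<in> Ar C. Dom C f = A \<and> Cod C f = B}"

locale category =
  fixes C :: "('o, 'm, 'z) precat_scheme" (structure)
  assumes dom_ob: "f \<in> Ar C \<Longrightarrow> Dom C f \<in> Ob C"
    and cod_ob: "f \<in> Ar C \<Longrightarrow> Cod C f \<in> Ob C"
    and id_hom: "A \<in> Ob C \<Longrightarrow> Id C A \<in> Hom C A A"
    and comp_hom: "\<lbrakk>f \<in> Hom C A B; g \<in> Hom C B D\<rbrakk> \<Longrightarrow> g \<cdot> f \<in> Hom C A D"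
    and comp_assoc: "\<lbrakk>f \<in> Hom C A B; g \<in> Hom C B D; h \<in> Hom C D E\<rbrakk>
      \<Longrightarrow> (h \<cdot> g) \<cdot> f = h \<cdot> (g \<cdot> f)"
    and id_left: "f \<in> Hom C A B \<Longrightarrow> Id C B \<cdot> f = f"
    and id_right: "f \<in> Hom C A B \<Longrightarrow> f \<cdot> Id C A = f"

definition is_inverse :: "('o, 'm, 'z) precat_scheme \<Rightarrow> 'm \<Rightarrow> 'm \<Rightarrow> bool" where
  "is_inverse C f g \<longleftrightarrow> f \<in> Hom C (Dom C f) (Cod C f) \<and> g \<in> Hom C (Cod C f) (Dom C f) \<and>
     g \<cdot>\<^bsub>C\<^esub> f = Id C (Dom C f) \<and> f \<cdot>\<^bsub>C\<^esub> g = Id C (Cod C f)"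

definition is_iso :: "('o, 'm, 'z) precat_scheme \<Rightarrow> 'm \<Rightarrow> bool" where
  "is_iso C f \<longleftrightarrow> (\<exists>g. is_inverse C f g)"

definition inverse_arrow :: "('o, 'm, 'z) precat_scheme \<Rightarrow> 'm \<Rightarrow> 'm" where
  "inverse_arrow C f = (THE g. is_inverse C f g)"

definition zero_object :: "('o, 'm, 'z) precat_scheme \<Rightarrow> 'o \<Rightarrow> bool" where
  "zero_object C O' \<longleftrightarrow> O' \<in> Ob C \<and>
     (\<forall>A \<in> Ob C. (\<exists>!f. f \<in> Hom C O' A) \<and> (\<exists>!f. f \<in> Hom C A O'))"

record ('o, 'm, 'p, 'n) cfunctor =
  fob :: "'o \<Rightarrow> 'p"
  far :: "'m \<Rightarrow> 'n"

locale cat_functor = C: category C + D: category D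
  for C :: "('o, 'm, 'y) precat_scheme" and D :: "('p, 'n, 'z) precat_scheme"
    and F :: "('o, 'm, 'p, 'n, 'f) cfunctor_scheme" +
  assumes fob_ob: "A \<in> Ob C \<Longrightarrow> fob F A \<in> Ob D"
    and far_hom: "f \<in> Hom C A B \<Longrightarrow> far F f \<in> Hom D (fob F A) (fob F B)"
    and far_id: "A \<in> Ob C \<Longrightarrow> far F (Id C A) = Id D (fob F A)"
    and far_comp: "\<lbrakk>f \<in> Hom C A B; g \<in> Hom C B E\<rbrakk>
      \<Longrightarrow> far F (g \<cdot>\<^bsub>C\<^esub> f) = far F g \<cdot>\<^bsub>D\<^esub> far F f"

definition fully_faithful ::
  "('o, 'm, 'y) precat_scheme \<Rightarrow> ('p, 'n, 'z) precat_scheme \<Rightarrow>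
   ('o, 'm, 'p, 'n, 'f) cfunctor_scheme \<Rightarrow> bool" where
  "fully_faithful C D F \<longleftrightarrow>
     (\<forall>A \<in> Ob C. \<forall>B \<in> Ob C. bij_betw (far F) (Hom C A B) (Hom D (fob F A) (fob F B)))"

definition id_functor :: "('o, 'm, 'o, 'm) cfunctor" where
  "id_functor = \<lparr>fob = \<lambda>A. A, far = \<lambda>f. f\<rparr>"

definition comp_functor ::
  "('p, 'n, 'q, 'k, 'g) cfunctor_scheme \<Rightarrow> ('o, 'm, 'p, 'n, 'f) cfunctor_scheme \<Rightarrow>
   ('o, 'm, 'q, 'k) cfunctor"  (infixr "\<odot>" 75) where
  "G \<odot> F = \<lparr>fob = \<lambda>A. fob G (fob F A), far = \<lambda>f. far G (far F f)\<rparr>"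

definition natural_trans ::
  "('o, 'm, 'y) precat_scheme \<Rightarrow> ('p, 'n, 'z) precat_scheme \<Rightarrow>
   ('o, 'm, 'p, 'n, 'f) cfunctor_scheme \<Rightarrow> ('o, 'm, 'p, 'n, 'g) cfunctor_scheme \<Rightarrow>
   ('o \<Rightarrow> 'n) \<Rightarrow> bool" where
  "natural_trans C D F G \<tau> \<longleftrightarrow>
     (\<forall>A \<in> Ob C. \<tau> A \<in> Hom D (fob F A) (fob G A)) \<and>
     (\<forall>A B. \<forall>f \<in> Hom C A B. \<tau> B \<cdot>\<^bsub>D\<^esub> far F f = far G f \<cdot>\<^bsub>D\<^esub> \<tau> A)"

text \<open>\<open>F\<close> is left adjoint to \<open>G\<close>, with unit \<open>\<eta>\<close> and counit \<open>\<epsilon>\<close>.\<close>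

locale adjunction = F: cat_functor C D F + G: cat_functor D C G
  for C :: "('o, 'm, 'y) precat_scheme" and D :: "('p, 'n, 'z) precat_scheme"
    and F :: "('o, 'm, 'p, 'n, 'f) cfunctor_scheme"
    and G :: "('p, 'n, 'o, 'm, 'g) cfunctor_scheme"
    and \<eta> :: "'o \<Rightarrow> 'm" and \<epsilon> :: "'p \<Rightarrow> 'n" +
  assumes unit_natural: "natural_trans C C id_functor (G \<odot> F) \<eta>"
    and counit_natural: "natural_trans D D (F \<odot> G) id_functor \<epsilon>"
    and triangle_left: "A \<in> Ob C \<Longrightarrow> \<epsilon> (fob F A) \<cdot>\<^bsub>D\<^esub> far F (\<eta> A) = Id D (fob F A)"
    and triangle_right: "B \<in> Ob D \<Longrightarrow> far G (\<epsilon> B) \<cdot>\<^bsub>C\<^esub> \<eta> (fob G B) = Id C (fob G B)"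


section \<open>Additive and triangulated categories\<close>

record ('o, 'm) addcat = "('o, 'm) precat" +
  Plus :: "'m \<Rightarrow> 'm \<Rightarrow> 'm"
  Zero :: "'o \<Rightarrow> 'o \<Rightarrow> 'm"

text \<open>The abelian group of morphisms, in the multiplicative notation of \<^theory>\<open>HOL-Algebra.Group\<close>.\<close>

definition hom_group :: "('o, 'm, 'z) addcat_scheme \<Rightarrow> 'o \<Rightarrow> 'o \<Rightarrow> 'm monoid" where
  "hom_group C A B = \<lparr>carrier = Hom C A B, mult = Plus C, one = Zero C A B\<rparr>"

definition Neg :: "('o, 'm, 'z) addcat_scheme \<Rightarrow> 'm \<Rightarrow> 'm" where
  "Neg C f = inv\<^bsub>hom_group C (Dom C f) (Cod C f)\<^esub> f"

locale additive_category = category C for C :: "('o, 'm, 'z) addcat_scheme" (structure) +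
  assumes hom_comm_group: "\<lbrakk>A \<in> Ob C; B \<in> Ob C\<rbrakk> \<Longrightarrow> comm_group (hom_group C A B)"
    and comp_plus_left: "\<lbrakk>f \<in> Hom C A B; g \<in> Hom C B D; g' \<in> Hom C B D\<rbrakk>
      \<Longrightarrow> Plus C g g' \<cdot> f = Plus C (g \<cdot> f) (g' \<cdot> f)"
    and comp_plus_right: "\<lbrakk>f \<in> Hom C A B; f' \<in> Hom C A B; g \<in> Hom C B D\<rbrakk>
      \<Longrightarrow> g \<cdot> Plus C f f' = Plus C (g \<cdot> f) (g \<cdot> f')"
    and ex_zero_object: "\<exists>O'. zero_object C O'"
    and ex_biproduct: "\<lbrakk>A \<in> Ob C; B \<in> Ob C\<rbrakk> \<Longrightarrow>
      \<exists>S \<in> Ob C. \<exists>i \<in> Hom C A S. \<exists>k \<in> Hom C B S. \<exists>p \<in> Hom C S A. \<exists>q \<in> Hom C S B.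
        p \<cdot> i = Id C A \<and> q \<cdot> k = Id C B \<and> q \<cdot> i = Zero C A B \<and> p \<cdot> k = Zero C B A \<and>
        Plus C (i \<cdot> p) (k \<cdot> q) = Id C S"

definition additive_map ::
  "('o, 'm, 'y) addcat_scheme \<Rightarrow> ('p, 'n, 'z) addcat_scheme \<Rightarrow>
   ('o, 'm, 'p, 'n, 'f) cfunctor_scheme \<Rightarrow> bool" where
  "additive_map C D F \<longleftrightarrow> (\<forall>A B. \<forall>f \<in> Hom C A B. \<forall>g \<in> Hom C A B.
     far F (Plus C f g) = Plus D (far F f) (far F g))"

text \<open>
  A triangle \<open>X \<rightarrow> Y \<rightarrow> Z \<rightarrow> X[1]\<close> is recorded by its three morphisms. The translation functors
  \<open>[n]\<close>, \<open>n\<close> an integer, form a strict action of the integers.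
\<close>

record ('o, 'm) tricat = "('o, 'm) addcat" +
  Shift :: "int \<Rightarrow> ('o, 'm, 'o, 'm) cfunctor"
  Dist :: "('m \<times> 'm \<times> 'm) set"

abbreviation sh :: "('o, 'm, 'z) tricat_scheme \<Rightarrow> int \<Rightarrow> 'o \<Rightarrow> 'o" where
  "sh C n A \<equiv> fob (Shift C n) A"

abbreviation shm :: "('o, 'm, 'z) tricat_scheme \<Rightarrow> int \<Rightarrow> 'm \<Rightarrow> 'm" where
  "shm C n f \<equiv> far (Shift C n) f"

definition is_triangle :: "('o, 'm, 'z) tricat_scheme \<Rightarrow> 'm \<Rightarrow> 'm \<Rightarrow> 'm \<Rightarrow> bool" where
  "is_triangle C f g h \<longleftrightarrow>
     (\<exists>X Y Z. f \<in> Hom C X Y \<and> g \<in> Hom C Y Z \<and> h \<in> Hom C Z (sh C 1 X))"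

definition triangle_mor ::
  "('o, 'm, 'z) tricat_scheme \<Rightarrow> 'm \<times> 'm \<times> 'm \<Rightarrow> 'm \<times> 'm \<times> 'm \<Rightarrow> 'm \<Rightarrow> 'm \<Rightarrow> 'm \<Rightarrow> bool" where
  "triangle_mor C = (\<lambda>(f, g, h) (f', g', h') a b c.
     a \<in> Hom C (Dom C f) (Dom C f') \<and> b \<in> Hom C (Dom C g) (Dom C g') \<and>
     c \<in> Hom C (Dom C h) (Dom C h') \<and>
     b \<cdot>\<^bsub>C\<^esub> f = f' \<cdot>\<^bsub>C\<^esub> a \<and> c \<cdot>\<^bsub>C\<^esub> g = g' \<cdot>\<^bsub>C\<^esub> b \<and> shm C 1 a \<cdot>\<^bsub>C\<^esub> h = h' \<cdot>\<^bsub>C\<^esub> c)"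

locale triangulated_category = additive_category C
  for C :: "('o, 'm, 'z) tricat_scheme" (structure) +
  assumes shift_functor: "cat_functor C C (Shift C n)"
    and shift_additive: "additive_map C C (Shift C n)"
    and shift_zero_ob: "A \<in> Ob C \<Longrightarrow> sh C 0 A = A"
    and shift_zero_ar: "f \<in> Ar C \<Longrightarrow> shm C 0 f = f"
    and shift_add_ob: "A \<in> Ob C \<Longrightarrow> sh C m (sh C n A) = sh C (m + n) A"
    and shift_add_ar: "f \<in> Ar C \<Longrightarrow> shm C m (shm C n f) = shm C (m + n) f"
    and dist_triangle: "(f, g, h) \<in> Dist C \<Longrightarrow> is_triangle C f g h"
    and TR1_iso: "\<lbrakk>(f, g, h) \<in> Dist C; is_triangle C f' g' h';
        triangle_mor C (f, g, h) (f', g', h') a b c; is_iso C a; is_iso C b; is_iso C c\<rbrakk>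
      \<Longrightarrow> (f', g', h') \<in> Dist C"
    and TR1_id: "\<lbrakk>A \<in> Ob C; zero_object C O'\<rbrakk>
      \<Longrightarrow> (Id C A, Zero C A O', Zero C O' (sh C 1 A)) \<in> Dist C"
    and TR1_cone: "f \<in> Ar C \<Longrightarrow> \<exists>g h. (f, g, h) \<in> Dist C"
    and TR2: "is_triangle C f g h \<Longrightarrow>
      (f, g, h) \<in> Dist C \<longleftrightarrow> (g, h, Neg C (shm C 1 f)) \<in> Dist C"
    and TR3: "\<lbrakk>(f, g, h) \<in> Dist C; (f', g', h') \<in> Dist C;
        a \<in> Hom C (Dom C f) (Dom C f'); b \<in> Hom C (Cod C f) (Cod C f'); b \<cdot> f = f' \<cdot> a\<rbrakk>
      \<Longrightarrow> \<exists>c. triangle_mor C (f, g, h) (f', g', h') a b c"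
    and TR4: "\<lbrakk>f \<in> Hom C X Y; g \<in> Hom C Y Z;
        (f, p\<^sub>1, d\<^sub>1) \<in> Dist C; (g \<cdot> f, p\<^sub>2, d\<^sub>2) \<in> Dist C; (g, p\<^sub>3, d\<^sub>3) \<in> Dist C\<rbrakk>
      \<Longrightarrow> \<exists>a b. (a, b, shm C 1 p\<^sub>1 \<cdot> d\<^sub>3) \<in> Dist C \<and>
            triangle_mor C (f, p\<^sub>1, d\<^sub>1) (g \<cdot> f, p\<^sub>2, d\<^sub>2) (Id C X) g a \<and>
            triangle_mor C (g \<cdot> f, p\<^sub>2, d\<^sub>2) (g, p\<^sub>3, d\<^sub>3) f (Id C Z) b"

text \<open>
  An exact functor comes with isomorphisms \<open>F(A[n]) \<cong> (F A)[n]\<close>. The usual datum is the case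
  \<open>n = 1\<close>; the coherence condition determines the whole family from it.
\<close>

record ('o, 'm, 'p, 'n) exfunctor = "('o, 'm, 'p, 'n) cfunctor" +
  fsh :: "int \<Rightarrow> 'o \<Rightarrow> 'n"

locale exact_functor = C: triangulated_category C + D: triangulated_category D + cat_functor C D F
  for C :: "('o, 'm, 'y) tricat_scheme" and D :: "('p, 'n, 'z) tricat_scheme"
    and F :: "('o, 'm, 'p, 'n, 'f) exfunctor_scheme" +
  assumes additive: "additive_map C D F"
    and fsh_natural: "natural_trans C D (F \<odot> Shift C n) (Shift D n \<odot> F) (fsh F n)"
    and fsh_iso: "A \<in> Ob C \<Longrightarrow> is_iso D (fsh F n A)"
    and fsh_add: "A \<in> Ob C \<Longrightarrow>
      fsh F (m + n) A = shm D m (fsh F n A) \<cdot>\<^bsub>D\<^esub> fsh F m (sh C n A)"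
    and exact: "(f, g, h) \<in> Dist C \<Longrightarrow>
      (far F f, far F g, fsh F 1 (Dom C f) \<cdot>\<^bsub>D\<^esub> far F h) \<in> Dist D"

text \<open>
  An adjunction of exact functors: unit and counit are compatible with the translation
  isomorphisms, so that the counit at \<open>B[n]\<close> is identified with the \<open>n\<close>-th translate of the
  counit at \<open>B\<close>.
\<close>

locale exact_adjunction =
  F: exact_functor C D F + G: exact_functor D C G + adjunction C D F G \<eta> \<epsilon>
  for C :: "('o, 'm, 'y) tricat_scheme" and D :: "('p, 'n, 'z) tricat_scheme"
    and F :: "('o, 'm, 'p, 'n, 'f) exfunctor_scheme"
    and G :: "('p, 'n, 'o, 'm, 'g) exfunctor_scheme"
    and \<eta> :: "'o \<Rightarrow> 'm" and \<epsilon> :: "'p \<Rightarrow> 'n" +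
  assumes unit_shift: "A \<in> Ob C \<Longrightarrow>
      fsh G n (fob F A) \<cdot>\<^bsub>C\<^esub> far G (fsh F n A) \<cdot>\<^bsub>C\<^esub> \<eta> (sh C n A) = shm C n (\<eta> A)"
    and counit_shift: "B \<in> Ob D \<Longrightarrow>
      shm D n (\<epsilon> B) \<cdot>\<^bsub>D\<^esub> fsh F n (fob G B) \<cdot>\<^bsub>D\<^esub> far F (fsh G n B) = \<epsilon> (sh D n B)"


section \<open>Symmetric monoidal structures\<close>

record ('o, 'm) ttcat = "('o, 'm) tricat" +
  tensO :: "'o \<Rightarrow> 'o \<Rightarrow> 'o"
  tensM :: "'m \<Rightarrow> 'm \<Rightarrow> 'm"
  unitO :: 'o
  assoc :: "'o \<Rightarrow> 'o \<Rightarrow> 'o \<Rightarrow> 'm"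
  lunit :: "'o \<Rightarrow> 'm"
  runit :: "'o \<Rightarrow> 'm"
  braid :: "'o \<Rightarrow> 'o \<Rightarrow> 'm"

locale symmetric_monoidal_category = category C
  for C :: "('o, 'm, 'z) ttcat_scheme" (structure) +
  assumes tensO_ob: "\<lbrakk>A \<in> Ob C; B \<in> Ob C\<rbrakk> \<Longrightarrow> tensO C A B \<in> Ob C"
    and tensM_hom: "\<lbrakk>f \<in> Hom C A B; g \<in> Hom C A' B'\<rbrakk>
      \<Longrightarrow> tensM C f g \<in> Hom C (tensO C A A') (tensO C B B')"
    and tensM_id: "\<lbrakk>A \<in> Ob C; B \<in> Ob C\<rbrakk> \<Longrightarrow> tensM C (Id C A) (Id C B) = Id C (tensO C A B)"
    and tensM_comp: "\<lbrakk>f \<in> Hom C A B; g \<in> Hom C B D; f' \<in> Hom C A' B'; g' \<in> Hom C B' D'\<rbrakk>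
      \<Longrightarrow> tensM C (g \<cdot> f) (g' \<cdot> f') = tensM C g g' \<cdot> tensM C f f'"
    and unitO_ob: "unitO C \<in> Ob C"
    and assoc_hom: "\<lbrakk>A \<in> Ob C; B \<in> Ob C; D \<in> Ob C\<rbrakk> \<Longrightarrow>
      assoc C A B D \<in> Hom C (tensO C (tensO C A B) D) (tensO C A (tensO C B D))"
    and assoc_iso: "\<lbrakk>A \<in> Ob C; B \<in> Ob C; D \<in> Ob C\<rbrakk> \<Longrightarrow> is_iso C (assoc C A B D)"
    and assoc_natural: "\<lbrakk>f \<in> Hom C A A'; g \<in> Hom C B B'; h \<in> Hom C D D'\<rbrakk> \<Longrightarrow>
      assoc C A' B' D' \<cdot> tensM C (tensM C f g) h = tensM C f (tensM C g h) \<cdot> assoc C A B D"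
    and lunit_hom: "A \<in> Ob C \<Longrightarrow> lunit C A \<in> Hom C (tensO C (unitO C) A) A"
    and lunit_iso: "A \<in> Ob C \<Longrightarrow> is_iso C (lunit C A)"
    and lunit_natural: "f \<in> Hom C A B \<Longrightarrow>
      lunit C B \<cdot> tensM C (Id C (unitO C)) f = f \<cdot> lunit C A"
    and runit_hom: "A \<in> Ob C \<Longrightarrow> runit C A \<in> Hom C (tensO C A (unitO C)) A"
    and runit_iso: "A \<in> Ob C \<Longrightarrow> is_iso C (runit C A)"
    and runit_natural: "f \<in> Hom C A B \<Longrightarrow>
      runit C B \<cdot> tensM C f (Id C (unitO C)) = f \<cdot> runit C A"
    and braid_hom: "\<lbrakk>A \<in> Ob C; B \<in> Ob C\<rbrakk> \<Longrightarrow> braid C A B \<in> Hom C (tensO C A B) (tensO C B A)"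
    and braid_natural: "\<lbrakk>f \<in> Hom C A A'; g \<in> Hom C B B'\<rbrakk> \<Longrightarrow>
      braid C A' B' \<cdot> tensM C f g = tensM C g f \<cdot> braid C A B"
    and braid_symmetric: "\<lbrakk>A \<in> Ob C; B \<in> Ob C\<rbrakk> \<Longrightarrow>
      braid C B A \<cdot> braid C A B = Id C (tensO C A B)"
    and pentagon: "\<lbrakk>A \<in> Ob C; B \<in> Ob C; D \<in> Ob C; E \<in> Ob C\<rbrakk> \<Longrightarrow>
      assoc C A B (tensO C D E) \<cdot> assoc C (tensO C A B) D E =
      tensM C (Id C A) (assoc C B D E) \<cdot> assoc C A (tensO C B D) E
        \<cdot> tensM C (assoc C A B D) (Id C E)"
    and unit_triangle: "\<lbrakk>A \<in> Ob C; B \<in> Ob C\<rbrakk> \<Longrightarrow>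
      tensM C (Id C A) (lunit C B) \<cdot> assoc C A (unitO C) B = tensM C (runit C A) (Id C B)"
    and hexagon: "\<lbrakk>A \<in> Ob C; B \<in> Ob C; D \<in> Ob C\<rbrakk> \<Longrightarrow>
      assoc C B D A \<cdot> braid C A (tensO C B D) \<cdot> assoc C A B D =
      tensM C (Id C B) (braid C A D) \<cdot> assoc C B A D \<cdot> tensM C (braid C A B) (Id C D)"

locale tt_category = triangulated_category C + symmetric_monoidal_category C
  for C :: "('o, 'm, 'z) ttcat_scheme"

text \<open>
  The structure isomorphisms are \<open>fmu F A B : F A \<otimes> F B \<rightarrow> F (A \<otimes> B)\<close> and
  \<open>funit F : 1 \<rightarrow> F 1\<close>.
\<close>

record ('o, 'm, 'p, 'n) smfunctor = "('o, 'm, 'p, 'n) exfunctor" +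
  fmu :: "'o \<Rightarrow> 'o \<Rightarrow> 'n"
  funit :: 'n

locale symmetric_monoidal_functor =
  C: symmetric_monoidal_category C + D: symmetric_monoidal_category D + cat_functor C D F
  for C :: "('o, 'm, 'y) ttcat_scheme" and D :: "('p, 'n, 'z) ttcat_scheme"
    and F :: "('o, 'm, 'p, 'n, 'f) smfunctor_scheme" +
  assumes fmu_hom: "\<lbrakk>A \<in> Ob C; B \<in> Ob C\<rbrakk> \<Longrightarrow>
      fmu F A B \<in> Hom D (tensO D (fob F A) (fob F B)) (fob F (tensO C A B))"
    and fmu_iso: "\<lbrakk>A \<in> Ob C; B \<in> Ob C\<rbrakk> \<Longrightarrow> is_iso D (fmu F A B)"
    and fmu_natural: "\<lbrakk>f \<in> Hom C A A'; g \<in> Hom C B B'\<rbrakk> \<Longrightarrow>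
      fmu F A' B' \<cdot>\<^bsub>D\<^esub> tensM D (far F f) (far F g) = far F (tensM C f g) \<cdot>\<^bsub>D\<^esub> fmu F A B"
    and funit_hom: "funit F \<in> Hom D (unitO D) (fob F (unitO C))"
    and funit_iso: "is_iso D (funit F)"
    and fmu_assoc: "\<lbrakk>A \<in> Ob C; B \<in> Ob C; E \<in> Ob C\<rbrakk> \<Longrightarrow>
      far F (assoc C A B E) \<cdot>\<^bsub>D\<^esub> fmu F (tensO C A B) E
        \<cdot>\<^bsub>D\<^esub> tensM D (fmu F A B) (Id D (fob F E)) =
      fmu F A (tensO C B E) \<cdot>\<^bsub>D\<^esub> tensM D (Id D (fob F A)) (fmu F B E)
        \<cdot>\<^bsub>D\<^esub> assoc D (fob F A) (fob F B) (fob F E)"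
    and fmu_lunit: "A \<in> Ob C \<Longrightarrow>
      far F (lunit C A) \<cdot>\<^bsub>D\<^esub> fmu F (unitO C) A \<cdot>\<^bsub>D\<^esub> tensM D (funit F) (Id D (fob F A)) =
      lunit D (fob F A)"
    and fmu_runit: "A \<in> Ob C \<Longrightarrow>
      far F (runit C A) \<cdot>\<^bsub>D\<^esub> fmu F A (unitO C) \<cdot>\<^bsub>D\<^esub> tensM D (Id D (fob F A)) (funit F) =
      runit D (fob F A)"
    and fmu_braid: "\<lbrakk>A \<in> Ob C; B \<in> Ob C\<rbrakk> \<Longrightarrow>
      far F (braid C A B) \<cdot>\<^bsub>D\<^esub> fmu F A B = fmu F B A \<cdot>\<^bsub>D\<^esub> braid D (fob F A) (fob F B)"


section \<open>Coefficient systems and recollement\<close>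

text \<open>
  All the categories \<open>coeff K X\<close> share one type of objects and one type of morphisms; any family
  of categories can be brought into this form by taking disjoint unions. \<open>open_compl K\<close> consists
  of the pairs \<open>(i, j)\<close> of a closed immersion \<open>i\<close> with its open complement \<open>j\<close>. For
  \<open>f : X \<rightarrow> Y\<close>, \<open>pull K f\<close> and \<open>push K f\<close> are the inverse and direct image functors, and
  \<open>un K f\<close>, \<open>cn K f\<close> are the unit and counit of their adjunction.
\<close>

record ('s, 'f, 'o, 'm) coeff_system =
  spaces :: "('s, 'f) precat"
  closed_imm :: "'f set"
  open_compl :: "('f \<times> 'f) set"
  coeff :: "'s \<Rightarrow> ('o, 'm) ttcat"
  pull :: "'f \<Rightarrow> ('o, 'm, 'o, 'm) smfunctor"
  push :: "'f \<Rightarrow> ('o, 'm, 'o, 'm) exfunctor"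
  un :: "'f \<Rightarrow> 'o \<Rightarrow> 'm"
  cn :: "'f \<Rightarrow> 'o \<Rightarrow> 'm"

locale coefficient_system =
  fixes K :: "('s, 'f, 'o, 'm) coeff_system"
  assumes spaces_category: "category (spaces K)"
    and closed_imm_ar: "i \<in> closed_imm K \<Longrightarrow> i \<in> Ar (spaces K)"
    and open_compl_closed: "(i, j) \<in> open_compl K \<Longrightarrow> i \<in> closed_imm K"
    and open_compl_ar: "(i, j) \<in> open_compl K \<Longrightarrow> j \<in> Ar (spaces K)"
    and open_compl_cod: "(i, j) \<in> open_compl K \<Longrightarrow> Cod (spaces K) j = Cod (spaces K) i"
    and ex_open_compl: "i \<in> closed_imm K \<Longrightarrow> \<exists>j. (i, j) \<in> open_compl K"
    and coeff_tt: "X \<in> Ob (spaces K) \<Longrightarrow> tt_category (coeff K X)"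
    and pull_push: "f \<in> Hom (spaces K) X Y \<Longrightarrow>
      exact_adjunction (coeff K Y) (coeff K X) (pull K f) (push K f) (un K f) (cn K f)"
    and pull_monoidal: "f \<in> Hom (spaces K) X Y \<Longrightarrow>
      symmetric_monoidal_functor (coeff K Y) (coeff K X) (pull K f)"

text \<open>
  The further data of a recollement: the functors \<open>i\<^sup>!\<close> and \<open>j\<^sub>!\<close>, the units and counits of
  \<open>i\<^sub>* \<stileturn> i\<^sup>!\<close> and \<open>j\<^sub>! \<stileturn> j\<^sup>*\<close>, and the third maps
  \<open>i\<^sub>* i\<^sup>* M \<rightarrow> (j\<^sub>! j\<^sup>* M)[1]\<close> and \<open>j\<^sub>* j\<^sup>* M \<rightarrow> (i\<^sub>* i\<^sup>! M)[1]\<close> of the two triangles.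
\<close>

record ('o, 'm) recollement_data =
  upper_shriek :: "('o, 'm, 'o, 'm) exfunctor"
  lower_shriek :: "('o, 'm, 'o, 'm) exfunctor"
  shriek_un_i :: "'o \<Rightarrow> 'm"
  shriek_cn_i :: "'o \<Rightarrow> 'm"
  shriek_un_j :: "'o \<Rightarrow> 'm"
  shriek_cn_j :: "'o \<Rightarrow> 'm"
  bd_i :: "'o \<Rightarrow> 'm"
  bd_j :: "'o \<Rightarrow> 'm"

locale recollement =
  fixes K :: "('s, 'f, 'o, 'm) coeff_system" and i j :: 'f
    and R :: "('o, 'm) recollement_data" and X Z U :: 's and CX CZ CU :: "('o, 'm) ttcat"
  defines "X \<equiv> Cod (spaces K) i" and "Z \<equiv> Dom (spaces K) i" and "U \<equiv> Dom (spaces K) j"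
    and "CX \<equiv> coeff K X" and "CZ \<equiv> coeff K Z" and "CU \<equiv> coeff K U"
  assumes i_shriek_adj: "exact_adjunction CZ CX
      (push K i) (upper_shriek R) (shriek_un_i R) (shriek_cn_i R)"
    and j_shriek_adj: "exact_adjunction CU CX
      (lower_shriek R) (pull K j) (shriek_un_j R) (shriek_cn_j R)"
    and i_push_ff: "fully_faithful CZ CX (push K i)"
    and j_shriek_ff: "fully_faithful CU CX (lower_shriek R)"
    and j_pull_i_push: "N \<in> Ob CZ \<Longrightarrow> zero_object CU (fob (pull K j) (fob (push K i) N))"
    and i_pull_j_shriek: "N \<in> Ob CU \<Longrightarrow> zero_object CZ (fob (pull K i) (fob (lower_shriek R) N))"
    and bd_i_natural: "natural_trans CX CX (push K i \<odot> pull K i)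
      (Shift CX 1 \<odot> lower_shriek R \<odot> pull K j) (bd_i R)"
    and bd_j_natural: "natural_trans CX CX (push K j \<odot> pull K j)
      (Shift CX 1 \<odot> push K i \<odot> upper_shriek R) (bd_j R)"
    and gluing_triangle: "M \<in> Ob CX \<Longrightarrow> (shriek_cn_j R M, un K i M, bd_i R M) \<in> Dist CX"
    and localisation_triangle: "M \<in> Ob CX \<Longrightarrow> (shriek_cn_i R M, un K j M, bd_j R M) \<in> Dist CX"


section \<open>Cohomology, localisation and localised classes\<close>

definition cohom :: "('o, 'm, 'z) ttcat_scheme \<Rightarrow> int \<Rightarrow> 'o \<Rightarrow> 'm monoid" where
  "cohom C d A = hom_group C (unitO C) (sh C d A)"

definition i_shriek_i :: "('s, 'f, 'o, 'm) coeff_system \<Rightarrow> 'f \<Rightarrow> ('o, 'm) recollement_data \<Rightarrow> 'o \<Rightarrow> 'o"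
  where "i_shriek_i K i R A = fob (push K i) (fob (upper_shriek R) A)"

definition cohom_supp ::
  "('s, 'f, 'o, 'm) coeff_system \<Rightarrow> 'f \<Rightarrow> ('o, 'm) recollement_data \<Rightarrow> int \<Rightarrow> 'o \<Rightarrow> 'm monoid" where
  "cohom_supp K i R d A = cohom (coeff K (Cod (spaces K) i)) d (i_shriek_i K i R A)"

definition forg ::
  "('s, 'f, 'o, 'm) coeff_system \<Rightarrow> 'f \<Rightarrow> ('o, 'm) recollement_data \<Rightarrow> int \<Rightarrow> 'o \<Rightarrow> 'm \<Rightarrow> 'm" where
  "forg K i R d A c = (let C = coeff K (Cod (spaces K) i)
     in shm C d (shriek_cn_i R A) \<cdot>\<^bsub>C\<^esub> c)"

text \<open>
  For \<open>f : X \<rightarrow> Y\<close>, the pullback of \<open>c : 1\<^sub>Y \<rightarrow> A[d]\<close> is the composite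
  \<open>1\<^sub>X \<cong> f\<^sup>* 1\<^sub>Y \<rightarrow> f\<^sup>*(A[d]) \<cong> (f\<^sup>* A)[d]\<close>.
\<close>

definition pullback_class ::
  "('s, 'f, 'o, 'm) coeff_system \<Rightarrow> 'f \<Rightarrow> int \<Rightarrow> 'o \<Rightarrow> 'm \<Rightarrow> 'm" where
  "pullback_class K f d A c = (let C = coeff K (Dom (spaces K) f)
     in fsh (pull K f) d A \<cdot>\<^bsub>C\<^esub> far (pull K f) c \<cdot>\<^bsub>C\<^esub> funit (pull K f))"

text \<open>
  For \<open>f : X \<rightarrow> Y\<close>, the isomorphism \<open>Hom(1\<^sub>Y, (f\<^sub>* B)[d]) \<cong> Hom(1\<^sub>X, B[d])\<close> given by
  \<open>f\<^sup>* \<stileturn> f\<^sub>*\<close> and \<open>f\<^sup>* 1\<^sub>Y \<cong> 1\<^sub>X\<close>.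
\<close>

definition adjunct :: "('s, 'f, 'o, 'm) coeff_system \<Rightarrow> 'f \<Rightarrow> int \<Rightarrow> 'o \<Rightarrow> 'm \<Rightarrow> 'm" where
  "adjunct K f d B a = (let C = coeff K (Dom (spaces K) f)
     in shm C d (cn K f B) \<cdot>\<^bsub>C\<^esub> pullback_class K f d (fob (push K f) B) a)"

text \<open>
  The connecting morphism \<open>H\<^sup>d(U; j\<^sup>* A) \<rightarrow> H\<^sub>Z\<^sup>d\<^sup>+\<^sup>1(X; A)\<close>: identify the source with
  \<open>Hom(1\<^sub>X, (j\<^sub>* j\<^sup>* A)[d])\<close> and compose with \<open>(j\<^sub>* j\<^sup>* A)[d] \<rightarrow> (i\<^sub>* i\<^sup>! A)[1][d]\<close>,
  which is the object \<open>(i\<^sub>* i\<^sup>! A)[d + 1]\<close>. The sign \<open>(-1)\<^sup>d\<close> that some conventions for rotating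
  the triangle would introduce is omitted.
\<close>

definition connecting ::
  "('s, 'f, 'o, 'm) coeff_system \<Rightarrow> 'f \<Rightarrow> 'f \<Rightarrow> ('o, 'm) recollement_data \<Rightarrow> int \<Rightarrow> 'o \<Rightarrow> 'm \<Rightarrow> 'm" where
  "connecting K i j R d A b =
     (let C = coeff K (Cod (spaces K) i); B = fob (pull K j) A
      in shm C d (bd_j R A) \<cdot>\<^bsub>C\<^esub>
         inv_into (carrier (cohom C d (fob (push K j) B))) (adjunct K j d B) b)"

definition im_connecting ::
  "('s, 'f, 'o, 'm) coeff_system \<Rightarrow> 'f \<Rightarrow> 'f \<Rightarrow> ('o, 'm) recollement_data \<Rightarrow> int \<Rightarrow> 'o \<Rightarrow> 'm set" where
  "im_connecting K i j R d A =
     connecting K i j R d A `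
       carrier (cohom (coeff K (Dom (spaces K) j)) d (fob (pull K j) A))"

definition Lift ::
  "('s, 'f, 'o, 'm) coeff_system \<Rightarrow> 'f \<Rightarrow> ('o, 'm) recollement_data \<Rightarrow> int \<Rightarrow> 'o \<Rightarrow> 'm \<Rightarrow> 'm set" where
  "Lift K i R d A c = {c' \<in> carrier (cohom_supp K i R d A). forg K i R d A c' = c}"

text \<open>The group \<open>Hom(1\<^sub>Z, (i\<^sup>! A)[d])\<close> and the isomorphism from \<open>H\<^sub>Z\<^sup>d(X; A)\<close> onto it.\<close>

definition loc_group ::
  "('s, 'f, 'o, 'm) coeff_system \<Rightarrow> 'f \<Rightarrow> ('o, 'm) recollement_data \<Rightarrow> int \<Rightarrow> 'o \<Rightarrow> 'm monoid" where
  "loc_group K i R d A = cohom (coeff K (Dom (spaces K) i)) d (fob (upper_shriek R) A)"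

definition loc_adj ::
  "('s, 'f, 'o, 'm) coeff_system \<Rightarrow> 'f \<Rightarrow> ('o, 'm) recollement_data \<Rightarrow> int \<Rightarrow> 'o \<Rightarrow> 'm \<Rightarrow> 'm" where
  "loc_adj K i R d A = adjunct K i d (fob (upper_shriek R) A)"

definition Loc_tor ::
  "('s, 'f, 'o, 'm) coeff_system \<Rightarrow> 'f \<Rightarrow> ('o, 'm) recollement_data \<Rightarrow> int \<Rightarrow> 'o \<Rightarrow> 'm \<Rightarrow> 'm set" where
  "Loc_tor K i R d A c = loc_adj K i R d A ` Lift K i R d A c"

text \<open>The canonical localised class; meaningful only if \<^const>\<open>Loc_tor\<close> is a singleton.\<close>

definition Loc ::
  "('s, 'f, 'o, 'm) coeff_system \<Rightarrow> 'f \<Rightarrow> ('o, 'm) recollement_data \<Rightarrow> int \<Rightarrow> 'o \<Rightarrow> 'm \<Rightarrow> 'm" where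
  "Loc K i R d A c = the_elem (Loc_tor K i R d A c)"

text \<open>The identification \<open>(i\<^sub>* i\<^sup>! A)[d] \<cong> i\<^sub>* i\<^sup>! (A[d])\<close>.\<close>

definition shift_ident ::
  "('s, 'f, 'o, 'm) coeff_system \<Rightarrow> 'f \<Rightarrow> ('o, 'm) recollement_data \<Rightarrow> int \<Rightarrow> 'o \<Rightarrow> 'm" where
  "shift_ident K i R d A = (let C = coeff K (Cod (spaces K) i)
     in inverse_arrow C
          (fsh (push K i) d (fob (upper_shriek R) A) \<cdot>\<^bsub>C\<^esub> far (push K i) (fsh (upper_shriek R) d A)))"

definition torsor :: "('g, 'z) monoid_scheme \<Rightarrow> 'e set \<Rightarrow> ('g \<Rightarrow> 'e \<Rightarrow> 'e) \<Rightarrow> bool" where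
  "torsor G S \<phi> \<longleftrightarrow> transitive_action G S \<phi> \<and> S \<noteq> {} \<and> (\<forall>s \<in> S. stabilizer G \<phi> s = {\<one>\<^bsub>G\<^esub>})"

end

(*
  The shifted localisation triangle gives exact sequences of groups Hom(1, -), so ker(forg) is the
  image of the boundary map. By naturality of the translation isomorphisms and a triangle identity,
  the adjunct of the composite of c with the unit A -> j_* j^* A is the pullback of c to U; as
  taking adjuncts is injective, the composite vanishes and c lifts. The lifts therefore form a
  coset of im(delta), and a group isomorphism carries the torsor along. Compatibility of the
  counit with translations identifies the counit at A[d] with the map that defines forg.
*)
theory Submission
  imports Defs
begin

section \<open>Categories and additive functors\<close>

lemma Hom_simps: "f \<in> Hom C A B \<Longrightarrow> Dom C f = A" "f \<in> Hom C A B \<Longrightarrow> Cod C f = B"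
    "f \<in> Hom C A B \<Longrightarrow> f \<in> Ar C"
  by (simp_all add: Hom_def)

section \<open>Inverses and isomorphisms\<close>

context category begin

lemma Hom_Ob:
  assumes "f \<in> Hom C A B"
  shows "A \<in> Ob C" "B \<in> Ob C"
  using assms dom_ob cod_ob by (auto simp: Hom_def)

text \<open>g' = g' (f g) = (g' f) g = g. This is what makes the definite description in
  \<open>inverse_arrow\<close> denote an inverse.\<close>

lemma is_inverse_unique:
  assumes "is_inverse C f g" "is_inverse C f g'"
  shows "g = g'"
proof -
  let ?A = "Dom C f" and ?B = "Cod C f"
  have f: "f \<in> Hom C ?A ?B" and g: "g \<in> Hom C ?B ?A" and g': "g' \<in> Hom C ?B ?A"
    and "g' \<cdot> f = Id C ?A" and "f \<cdot> g = Id C ?B"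
    using assms by (auto simp: is_inverse_def)
  then show ?thesis
    using comp_assoc[OF g f g'] id_left[OF g] id_right[OF g'] by simp
qed

lemma inverse_arrow:
  assumes "is_iso C f" "f \<in> Hom C A B"
  shows "inverse_arrow C f \<in> Hom C B A"
    and "inverse_arrow C f \<cdot> f = Id C A"
    and "f \<cdot> inverse_arrow C f = Id C B"
proof -
  have "is_inverse C f (inverse_arrow C f)"
    using assms(1) is_inverse_unique unfolding is_iso_def inverse_arrow_def by (metis theI)
  then show "inverse_arrow C f \<in> Hom C B A"
    and "inverse_arrow C f \<cdot> f = Id C A"
    and "f \<cdot> inverse_arrow C f = Id C B"
    using assms(2) by (auto simp: is_inverse_def Hom_def)
qed

lemma is_isoI:
  assumes "f \<in> Hom C A B" "g \<in> Hom C B A" "g \<cdot> f = Id C A" "f \<cdot> g = Id C B"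
  shows "is_iso C f"
  using assms unfolding is_iso_def is_inverse_def by (auto simp: Hom_simps)

lemma is_iso_comp:
  assumes f: "f \<in> Hom C A B" "is_iso C f" and g: "g \<in> Hom C B D" "is_iso C g"
  shows "is_iso C (g \<cdot> f)"
proof -
  note f' = inverse_arrow[OF f(2,1)] and g' = inverse_arrow[OF g(2,1)]
  let ?f = "inverse_arrow C f" and ?g = "inverse_arrow C g"
  show ?thesis
  proof (rule is_isoI)
    show "g \<cdot> f \<in> Hom C A D" by (rule comp_hom[OF f(1) g(1)])
    show "?f \<cdot> ?g \<in> Hom C D A" by (rule comp_hom[OF g'(1) f'(1)])
    have "(?f \<cdot> ?g) \<cdot> (g \<cdot> f) = ?f \<cdot> ((?g \<cdot> g) \<cdot> f)"
      using comp_assoc[OF comp_hom[OF f(1) g(1)] g'(1) f'(1)] comp_assoc[OF f(1) g(1) g'(1)] by simp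
    then show "(?f \<cdot> ?g) \<cdot> (g \<cdot> f) = Id C A"
      using f' g' id_left[OF f(1)] by simp
    have "(g \<cdot> f) \<cdot> (?f \<cdot> ?g) = g \<cdot> ((f \<cdot> ?f) \<cdot> ?g)"
      using comp_assoc[OF comp_hom[OF g'(1) f'(1)] f(1) g(1)] comp_assoc[OF g'(1) f'(1) f(1)] by simp
    then show "(g \<cdot> f) \<cdot> (?f \<cdot> ?g) = Id C D"
      using f' g' id_left[OF g'(1)] by simp
  qed
qed

lemma postcomp_iso_bij:
  assumes "is_iso C f" "f \<in> Hom C A B"
  shows "bij_betw ((\<cdot>) f) (Hom C T A) (Hom C T B)"
proof (rule bij_betw_byWitness[where f' = "(\<cdot>) (inverse_arrow C f)"])
  note inv = inverse_arrow[OF assms]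
  show "\<forall>x\<in>Hom C T A. inverse_arrow C f \<cdot> (f \<cdot> x) = x"
    using comp_assoc[OF _ assms(2) inv(1)] inv(2) id_left by auto
  show "\<forall>x\<in>Hom C T B. f \<cdot> (inverse_arrow C f \<cdot> x) = x"
    using comp_assoc[OF _ inv(1) assms(2)] inv(3) id_left by auto
  show "(\<cdot>) f ` Hom C T A \<subseteq> Hom C T B"
    using comp_hom[OF _ assms(2)] by auto
  show "(\<cdot>) (inverse_arrow C f) ` Hom C T B \<subseteq> Hom C T A"
    using comp_hom[OF _ inv(1)] by auto
qed

lemma precomp_iso_bij:
  assumes "is_iso C f" "f \<in> Hom C A B"
  shows "bij_betw (\<lambda>x. x \<cdot> f) (Hom C B T) (Hom C A T)"
proof (rule bij_betw_byWitness[where f' = "\<lambda>x. x \<cdot> inverse_arrow C f"])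
  note inv = inverse_arrow[OF assms]
  show "\<forall>x\<in>Hom C B T. (x \<cdot> f) \<cdot> inverse_arrow C f = x"
    using comp_assoc[OF inv(1) assms(2)] inv(3) id_right by auto
  show "\<forall>x\<in>Hom C A T. (x \<cdot> inverse_arrow C f) \<cdot> f = x"
    using comp_assoc[OF assms(2) inv(1)] inv(2) id_right by auto
  show "(\<lambda>x. x \<cdot> f) ` Hom C B T \<subseteq> Hom C A T"
    using comp_hom[OF assms(2)] by auto
  show "(\<lambda>x. x \<cdot> inverse_arrow C f) ` Hom C A T \<subseteq> Hom C B T"
    using comp_hom[OF inv(1)] by auto
qed

end

context cat_functor begin

lemma far_iso:
  assumes f: "f \<in> Hom C A B" and "is_iso C f"
  shows "is_iso D (far F f)"
proof -
  note inv = C.inverse_arrow[OF assms(2,1)]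
  show ?thesis
  proof (rule D.is_isoI[OF far_hom[OF f] far_hom[OF inv(1)]])
    show "far F (inverse_arrow C f) \<cdot>\<^bsub>D\<^esub> far F f = Id D (fob F A)"
      using far_comp[OF f inv(1)] inv(2) far_id C.Hom_Ob[OF f] by simp
    show "far F f \<cdot>\<^bsub>D\<^esub> far F (inverse_arrow C f) = Id D (fob F B)"
      using far_comp[OF inv(1) f] inv(3) far_id C.Hom_Ob[OF f] by simp
  qed
qed

end

lemma natural_transD:
  assumes "natural_trans C D F G \<tau>"
  shows "A \<in> Ob C \<Longrightarrow> \<tau> A \<in> Hom D (fob F A) (fob G A)"
    and "f \<in> Hom C A B \<Longrightarrow> \<tau> B \<cdot>\<^bsub>D\<^esub> far F f = far G f \<cdot>\<^bsub>D\<^esub> \<tau> A"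
  using assms by (auto simp: natural_trans_def)

text \<open>The inverse applies \<open>G\<close> and precomposes with the unit. One composite is the
  identity by naturality of \<eta> and \<open>triangle_right\<close>, the other by naturality of
  \<epsilon> and \<open>triangle_left\<close>.\<close>

lemma (in adjunction) transpose_bij:
  assumes T: "T \<in> Ob C" and B: "B \<in> Ob D"
  shows "bij_betw (\<lambda>x. \<epsilon> B \<cdot>\<^bsub>D\<^esub> far F x) (Hom C T (fob G B)) (Hom D (fob F T) B)"
proof (rule bij_betw_byWitness[where f' = "\<lambda>y. far G y \<cdot>\<^bsub>C\<^esub> \<eta> T"])
  have \<epsilon>: "\<epsilon> B \<in> Hom D (fob F (fob G B)) B"
    using natural_transD(1)[OF counit_natural B] by (simp add: comp_functor_def id_functor_def)
  have \<eta>: "\<eta> T \<in> Hom C T (fob G (fob F T))"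
    using natural_transD(1)[OF unit_natural T] by (simp add: comp_functor_def id_functor_def)
  have GB: "fob G B \<in> Ob C" using G.fob_ob[OF B] .
  have \<eta>': "\<eta> (fob G B) \<in> Hom C (fob G B) (fob G (fob F (fob G B)))"
    using natural_transD(1)[OF unit_natural GB] by (simp add: comp_functor_def id_functor_def)
  have FT: "fob F T \<in> Ob D" using F.fob_ob[OF T] .
  have \<epsilon>': "\<epsilon> (fob F T) \<in> Hom D (fob F (fob G (fob F T))) (fob F T)"
    using natural_transD(1)[OF counit_natural FT] by (simp add: comp_functor_def id_functor_def)
  show "\<forall>x\<in>Hom C T (fob G B). far G (\<epsilon> B \<cdot>\<^bsub>D\<^esub> far F x) \<cdot>\<^bsub>C\<^esub> \<eta> T = x"
  proof
    fix x assume x: "x \<in> Hom C T (fob G B)"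
    note Fx = F.far_hom[OF x]
    have "far G (\<epsilon> B \<cdot>\<^bsub>D\<^esub> far F x) \<cdot>\<^bsub>C\<^esub> \<eta> T = far G (\<epsilon> B) \<cdot>\<^bsub>C\<^esub> (far G (far F x) \<cdot>\<^bsub>C\<^esub> \<eta> T)"
      using G.far_comp[OF Fx \<epsilon>] F.C.comp_assoc[OF \<eta> G.far_hom[OF Fx] G.far_hom[OF \<epsilon>]] by simp
    also have "far G (far F x) \<cdot>\<^bsub>C\<^esub> \<eta> T = \<eta> (fob G B) \<cdot>\<^bsub>C\<^esub> x"
      using natural_transD(2)[OF unit_natural x] by (simp add: comp_functor_def id_functor_def)
    also have "far G (\<epsilon> B) \<cdot>\<^bsub>C\<^esub> (\<eta> (fob G B) \<cdot>\<^bsub>C\<^esub> x) = x"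
      using F.C.comp_assoc[OF x \<eta>' G.far_hom[OF \<epsilon>]] triangle_right[OF B] F.C.id_left[OF x] by simp
    finally show "far G (\<epsilon> B \<cdot>\<^bsub>D\<^esub> far F x) \<cdot>\<^bsub>C\<^esub> \<eta> T = x" .
  qed
  show "\<forall>y\<in>Hom D (fob F T) B. \<epsilon> B \<cdot>\<^bsub>D\<^esub> far F (far G y \<cdot>\<^bsub>C\<^esub> \<eta> T) = y"
  proof
    fix y assume y: "y \<in> Hom D (fob F T) B"
    note Gy = G.far_hom[OF y]
    have "\<epsilon> B \<cdot>\<^bsub>D\<^esub> far F (far G y \<cdot>\<^bsub>C\<^esub> \<eta> T) = (\<epsilon> B \<cdot>\<^bsub>D\<^esub> far F (far G y)) \<cdot>\<^bsub>D\<^esub> far F (\<eta> T)"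
      using F.far_comp[OF \<eta> Gy] F.D.comp_assoc[OF F.far_hom[OF \<eta>] F.far_hom[OF Gy] \<epsilon>] by simp
    also have "\<epsilon> B \<cdot>\<^bsub>D\<^esub> far F (far G y) = y \<cdot>\<^bsub>D\<^esub> \<epsilon> (fob F T)"
      using natural_transD(2)[OF counit_natural y] by (simp add: comp_functor_def id_functor_def)
    also have "(y \<cdot>\<^bsub>D\<^esub> \<epsilon> (fob F T)) \<cdot>\<^bsub>D\<^esub> far F (\<eta> T) = y"
      using F.D.comp_assoc[OF F.far_hom[OF \<eta>] \<epsilon>' y] triangle_left[OF T] F.D.id_right[OF y] by simp
    finally show "\<epsilon> B \<cdot>\<^bsub>D\<^esub> far F (far G y \<cdot>\<^bsub>C\<^esub> \<eta> T) = y" .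
  qed
  show "(\<lambda>x. \<epsilon> B \<cdot>\<^bsub>D\<^esub> far F x) ` Hom C T (fob G B) \<subseteq> Hom D (fob F T) B"
    using F.D.comp_hom[OF F.far_hom \<epsilon>] by auto
  show "(\<lambda>y. far G y \<cdot>\<^bsub>C\<^esub> \<eta> T) ` Hom D (fob F T) B \<subseteq> Hom C T (fob G B)"
    using F.C.comp_hom[OF \<eta> G.far_hom] by auto
qed

section \<open>Groups of morphisms and their homomorphisms\<close>

lemma hom_group_simps [simp]:
  "carrier (hom_group C A B) = Hom C A B"
  "\<one>\<^bsub>hom_group C A B\<^esub> = Zero C A B"
  "f \<otimes>\<^bsub>hom_group C A B\<^esub> g = Plus C f g"
  by (simp_all add: hom_group_def)

lemma additive_far_hom:
  assumes "cat_functor C D F" "additive_map C D F"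
  shows "far F \<in> hom (hom_group C A B) (hom_group D (fob F A) (fob F B))"
  using assms cat_functor.far_hom[OF assms(1)] by (auto simp: hom_def additive_map_def)

context additive_category begin

lemma hom_group_is_group: "\<lbrakk>A \<in> Ob C; B \<in> Ob C\<rbrakk> \<Longrightarrow> group (hom_group C A B)"
  using hom_comm_group comm_group_def by blast

lemma Zero_hom: "\<lbrakk>A \<in> Ob C; B \<in> Ob C\<rbrakk> \<Longrightarrow> Zero C A B \<in> Hom C A B"
  using group.is_monoid[OF hom_group_is_group, THEN monoid.one_closed] by simp

lemma postcomp_hom:
  "g \<in> Hom C B D \<Longrightarrow> (\<cdot>) g \<in> hom (hom_group C A B) (hom_group C A D)"
  by (auto simp: hom_def comp_plus_right intro: comp_hom)

lemma precomp_hom: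
  "f \<in> Hom C A B \<Longrightarrow> (\<lambda>g. g \<cdot> f) \<in> hom (hom_group C B D) (hom_group C A D)"
  by (auto simp: hom_def comp_plus_left intro: comp_hom)

lemma comp_Zero_right:
  assumes "A \<in> Ob C" "g \<in> Hom C B D"
  shows "g \<cdot> Zero C A B = Zero C A D"
  using hom_one[OF postcomp_hom[OF assms(2)] hom_group_is_group hom_group_is_group]
    assms Hom_Ob[OF assms(2)] by simp

lemma comp_Zero_left:
  assumes "D \<in> Ob C" "f \<in> Hom C A B"
  shows "Zero C B D \<cdot> f = Zero C A D"
  using hom_one[OF precomp_hom[OF assms(2)] hom_group_is_group hom_group_is_group]
    assms Hom_Ob[OF assms(2)] by simp

lemma Neg_inv: "f \<in> Hom C A B \<Longrightarrow> Neg C f = inv\<^bsub>hom_group C A B\<^esub> f"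
  by (simp add: Neg_def Hom_simps)

lemma Neg_hom: "f \<in> Hom C A B \<Longrightarrow> Neg C f \<in> Hom C A B"
  using group.inv_closed[OF hom_group_is_group, of A B f] by (simp add: Neg_inv Hom_Ob)

text \<open>Homomorphisms preserve inverses, and only the neutral element has neutral inverse. This
  disposes of the sign that rotating a triangle puts on a map whose kernel is wanted.\<close>

lemma hom_Neg_eq_Zero_iff:
  assumes \<phi>: "\<phi> \<in> hom (hom_group C A B) (hom_group C A' B')"
    and f: "f \<in> Hom C A B" and ob: "A' \<in> Ob C" "B' \<in> Ob C"
  shows "\<phi> (Neg C f) = Zero C A' B' \<longleftrightarrow> \<phi> f = Zero C A' B'"
proof -
  interpret H: group_hom "hom_group C A B" "hom_group C A' B'" \<phi>
    using \<phi> hom_group_is_group Hom_Ob[OF f] ob by (simp add: group_hom_def group_hom_axioms_def)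
  have "\<phi> (Neg C f) = inv\<^bsub>hom_group C A' B'\<^esub> \<phi> f"
    using H.hom_inv f by (simp add: Neg_inv)
  moreover have "\<phi> f \<in> carrier (hom_group C A' B')" using H.hom_closed f by simp
  ultimately show ?thesis using H.H.inv_eq_1_iff by simp
qed

end

section \<open>Exactness of distinguished triangles\<close>

context triangulated_category begin

lemma shm_hom: "f \<in> Hom C A B \<Longrightarrow> shm C n f \<in> Hom C (sh C n A) (sh C n B)"
  using cat_functor.far_hom[OF shift_functor] .

lemma shm_comp: "\<lbrakk>f \<in> Hom C A B; g \<in> Hom C B D\<rbrakk> \<Longrightarrow> shm C n (g \<cdot> f) = shm C n g \<cdot> shm C n f"
  using cat_functor.far_comp[OF shift_functor] .

lemma sh_ob: "A \<in> Ob C \<Longrightarrow> sh C n A \<in> Ob C"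
  using cat_functor.fob_ob[OF shift_functor] .

lemma shm_shm_cancel: "f \<in> Ar C \<Longrightarrow> m + n = 0 \<Longrightarrow> shm C m (shm C n f) = f"
  by (simp add: shift_add_ar shift_zero_ar)

lemma sh_sh_cancel: "A \<in> Ob C \<Longrightarrow> m + n = 0 \<Longrightarrow> sh C m (sh C n A) = A"
  by (simp add: shift_add_ob shift_zero_ob)

lemma shm_Zero:
  assumes "A \<in> Ob C" "B \<in> Ob C"
  shows "shm C n (Zero C A B) = Zero C (sh C n A) (sh C n B)"
  using hom_one[OF additive_far_hom[OF shift_functor shift_additive] hom_group_is_group hom_group_is_group]
    assms sh_ob by simp

lemma dist_third_hom:
  assumes "(f, g, h) \<in> Dist C" "f \<in> Hom C X Y" "g \<in> Hom C Y Z"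
  shows "h \<in> Hom C Z (sh C 1 X)"
  using dist_triangle[OF assms(1)] assms(2,3) by (auto simp: is_triangle_def Hom_def)

lemma dist_rotate:
  "(f, g, h) \<in> Dist C \<Longrightarrow> (g, h, Neg C (shm C 1 f)) \<in> Dist C"
  using TR2 dist_triangle by blast

text \<open>TR3 maps the triangle X = X -> 0 -> X[1] to the given one by \<open>Id C X\<close> and
  \<open>f\<close>. The third component starts at a zero object, so g f factors through
  zero.\<close>

lemma dist_comp_Zero:
  assumes fgh: "(f, g, h) \<in> Dist C" and f: "f \<in> Hom C X Y" and g: "g \<in> Hom C Y Z"
  shows "g \<cdot> f = Zero C X Z"
proof -
  note ob = Hom_Ob[OF f] Hom_Ob[OF g]
  obtain O' where O': "zero_object C O'" using ex_zero_object by blast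
  then have O'_ob: "O' \<in> Ob C" by (simp add: zero_object_def)
  note X = TR1_id[OF ob(1) O']
  note h = dist_third_hom[OF fgh f g]
  then obtain c where "triangle_mor C (Id C X, Zero C X O', Zero C O' (sh C 1 X)) (f, g, h) (Id C X) f c"
    using TR3[OF X fgh, of "Id C X" f] id_hom[OF ob(1)] f by (auto simp: Hom_simps)
  then have "c \<in> Hom C O' Z" "c \<cdot> Zero C X O' = g \<cdot> f"
    using Hom_simps[OF h] Hom_simps[OF Zero_hom[OF O'_ob sh_ob[OF ob(1)]]]
    by (auto simp: triangle_mor_def)
  then show ?thesis using comp_Zero_right[OF ob(1)] by metis
qed

text \<open>Compare the rotation of \<open>T = T \<rightarrow> 0 \<rightarrow> T[1]\<close> with the rotation of the given triangle;
  the two signs produced by the rotations cancel.\<close>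

lemma dist_lift:
  assumes fgh: "(f, g, h) \<in> Dist C" and f: "f \<in> Hom C X Y" and g: "g \<in> Hom C Y Z"
    and x: "x \<in> Hom C T Y" and gx: "g \<cdot> x = Zero C T Z"
  shows "\<exists>y \<in> Hom C T X. x = f \<cdot> y"
proof -
  note ob = Hom_Ob[OF f] Hom_Ob[OF g] Hom_Ob[OF x]
  obtain O' where O': "zero_object C O'" using ex_zero_object by blast
  then have O'_ob: "O' \<in> Ob C" by (simp add: zero_object_def)
  let ?I = "shm C 1 (Id C T)"
  note rT = dist_rotate[OF TR1_id[OF ob(5) O']] and rf = dist_rotate[OF fgh]
  note h = dist_third_hom[OF fgh f g]
  note Z = Zero_hom[OF ob(5) O'_ob] Zero_hom[OF O'_ob sh_ob[OF ob(5), of 1]] Zero_hom[OF O'_ob ob(4)]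
  have I: "?I \<in> Hom C (sh C 1 T) (sh C 1 T)" by (rule shm_hom[OF id_hom[OF ob(5)]])
  have f1: "shm C 1 f \<in> Hom C (sh C 1 X) (sh C 1 Y)" by (rule shm_hom[OF f])
  have x1: "shm C 1 x \<in> Hom C (sh C 1 T) (sh C 1 Y)" by (rule shm_hom[OF x])
  have "Zero C O' Z \<cdot> Zero C T O' = g \<cdot> x"
    using comp_Zero_right[OF ob(5) Z(3)] gx by simp
  \<comment> \<open>The hypothesis \<open>gx\<close> makes the square formed by \<open>x\<close> and
    0 -> Z commute. The component \<open>c : T[1] -> X[1]\<close> filled in by TR3 is the translate
    of the lift sought.\<close>
  then obtain c where c: "triangle_mor C (Zero C T O', Zero C O' (sh C 1 T), Neg C ?I)
      (g, h, Neg C (shm C 1 f)) x (Zero C O' Z) c"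
    using TR3[OF rT rf, of x "Zero C O' Z"] x g Z by (auto simp: Hom_simps)
  then have c_hom: "c \<in> Hom C (sh C 1 T) (sh C 1 X)"
    and c_eq: "shm C 1 x \<cdot> Neg C ?I = Neg C (shm C 1 f) \<cdot> c"
    using Hom_simps[OF Neg_hom[OF I]] Hom_simps[OF Neg_hom[OF f1]]
    by (auto simp: triangle_mor_def)
  \<comment> \<open>Both sides of \<open>c_eq\<close> are inverses in \<open>?G\<close>, because
    composition is a homomorphism in either argument; injectivity of inversion then removes the
    signs.\<close>
  let ?G = "hom_group C (sh C 1 T) (sh C 1 Y)"
  interpret G: group ?G using hom_group_is_group sh_ob ob by blast
  interpret L: group_hom "hom_group C (sh C 1 T) (sh C 1 T)" ?G "(\<cdot>) (shm C 1 x)"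
    using postcomp_hom[OF x1] hom_group_is_group sh_ob ob
    by (simp add: group_hom_def group_hom_axioms_def)
  interpret M: group_hom "hom_group C (sh C 1 X) (sh C 1 Y)" ?G "\<lambda>u. u \<cdot> c"
    using precomp_hom[OF c_hom] hom_group_is_group sh_ob ob
    by (simp add: group_hom_def group_hom_axioms_def)
  have "inv\<^bsub>?G\<^esub> (shm C 1 x \<cdot> ?I) = inv\<^bsub>?G\<^esub> (shm C 1 f \<cdot> c)"
    using c_eq L.hom_inv[of ?I] M.hom_inv[of "shm C 1 f"] I f1 by (simp add: Neg_inv)
  then have "shm C 1 x \<cdot> ?I = shm C 1 f \<cdot> c"
    using G.inv_inj L.hom_closed[of ?I] M.hom_closed[of "shm C 1 f"] I f1 by (auto simp: inj_on_def)
  moreover have "?I = Id C (sh C 1 T)" using cat_functor.far_id[OF shift_functor ob(5)] .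
  ultimately have "shm C 1 x = shm C 1 f \<cdot> c" using id_right[OF x1] by simp
  \<comment> \<open>Translations act strictly, so translating by -1 undoes the translation by 1 on
    the nose.\<close>
  then have "shm C (-1) (shm C 1 x) = shm C (-1) (shm C 1 f) \<cdot> shm C (-1) c"
    using shm_comp[OF c_hom f1] by simp
  then have "x = f \<cdot> shm C (-1) c"
    using shm_shm_cancel Hom_simps[OF x] Hom_simps[OF f] by simp
  moreover have "shm C (-1) c \<in> Hom C T X"
    using shm_hom[OF c_hom, of "-1"] sh_sh_cancel ob by simp
  ultimately show ?thesis by blast
qed

text \<open>The test object is moved to T[-n], where \<open>dist_lift\<close> applies to the
  original triangle; the n-th translate of the triangle itself would be distinguished only up to a
  sign. Strictness of the translations makes the passage back an equality.\<close>

lemma dist_exact_shift: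
  assumes fgh: "(f, g, h) \<in> Dist C" and f: "f \<in> Hom C X Y" and g: "g \<in> Hom C Y Z"
    and T: "T \<in> Ob C"
  shows "{x \<in> Hom C T (sh C n Y). shm C n g \<cdot> x = Zero C T (sh C n Z)}
      = (\<cdot>) (shm C n f) ` Hom C T (sh C n X)"
proof (intro equalityI subsetI)
  note ob = Hom_Ob[OF f] Hom_Ob[OF g]
  fix x assume "x \<in> {x \<in> Hom C T (sh C n Y). shm C n g \<cdot> x = Zero C T (sh C n Z)}"
  then have x: "x \<in> Hom C T (sh C n Y)" and gx: "shm C n g \<cdot> x = Zero C T (sh C n Z)" by auto
  let ?x = "shm C (- n) x"
  have x': "?x \<in> Hom C (sh C (- n) T) Y"
    using shm_hom[OF x, of "- n"] sh_sh_cancel ob by simp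
  have "g \<cdot> ?x = shm C (- n) (shm C n g \<cdot> x)"
    using shm_comp[OF x shm_hom[OF g]] shm_shm_cancel Hom_simps(3)[OF g] by simp
  then have "g \<cdot> ?x = Zero C (sh C (- n) T) Z"
    using gx shm_Zero sh_ob sh_sh_cancel ob T by simp
  then obtain y where y: "y \<in> Hom C (sh C (- n) T) X" "?x = f \<cdot> y"
    using dist_lift[OF fgh f g x'] by blast
  have "x = shm C n f \<cdot> shm C n y"
    using arg_cong[OF y(2), of "shm C n"] shm_comp[OF y(1) f] shm_shm_cancel Hom_simps(3)[OF x] by simp
  moreover have "shm C n y \<in> Hom C T (sh C n X)"
    using shm_hom[OF y(1), of n] sh_sh_cancel T by simp
  ultimately show "x \<in> (\<cdot>) (shm C n f) ` Hom C T (sh C n X)" by blast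
next
  note ob = Hom_Ob[OF f] Hom_Ob[OF g]
  fix x assume "x \<in> (\<cdot>) (shm C n f) ` Hom C T (sh C n X)"
  then obtain y where y: "y \<in> Hom C T (sh C n X)" and x: "x = shm C n f \<cdot> y" by blast
  have "shm C n g \<cdot> x = shm C n (g \<cdot> f) \<cdot> y"
    using comp_assoc[OF y shm_hom[OF f] shm_hom[OF g]] shm_comp[OF f g] x by simp
  also have "\<dots> = Zero C T (sh C n Z)"
    using dist_comp_Zero[OF fgh f g] shm_Zero comp_Zero_left[OF _ y] sh_ob ob by simp
  finally show "x \<in> {x \<in> Hom C T (sh C n Y). shm C n g \<cdot> x = Zero C T (sh C n Z)}"
    using x comp_hom[OF y shm_hom[OF f]] by simp
qed

text \<open>Two rotations give a triangle starting with \<open>h\<close> and -f[1], in which X[1] is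
  the middle term. Its exactness in degree n - 1 is the claim, since X[1][n-1] = X[n] and the sign
  does not change the kernel.\<close>

lemma dist_exact_shift_third:
  assumes fgh: "(f, g, h) \<in> Dist C" and f: "f \<in> Hom C X Y" and g: "g \<in> Hom C Y Z"
    and T: "T \<in> Ob C"
  shows "{x \<in> Hom C T (sh C n X). shm C n f \<cdot> x = Zero C T (sh C n Y)}
      = (\<cdot>) (shm C (n - 1) h) ` Hom C T (sh C (n - 1) Z)"
proof -
  note ob = Hom_Ob[OF f] Hom_Ob[OF g]
  note h = dist_third_hom[OF fgh f g]
  let ?f = "shm C 1 f" and ?m = "n - 1"
  have f1: "?f \<in> Hom C (sh C 1 X) (sh C 1 Y)" by (rule shm_hom[OF f])
  have sh_m: "sh C ?m (sh C 1 X) = sh C n X" "sh C ?m (sh C 1 Y) = sh C n Y"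
    using shift_add_ob ob by simp_all
  have "shm C ?m (Neg C ?f) \<cdot> x = Zero C T (sh C n Y) \<longleftrightarrow> shm C n f \<cdot> x = Zero C T (sh C n Y)"
    if x: "x \<in> Hom C T (sh C n X)" for x
  proof -
    \<comment> \<open>The homomorphism fed to \<open>hom_Neg_eq_Zero_iff\<close> is translation by n
      - 1 followed by precomposition with \<open>x\<close>, evaluated at f[1].\<close>
    have "shm C ?m \<in> hom (hom_group C (sh C 1 X) (sh C 1 Y)) (hom_group C (sh C n X) (sh C n Y))"
      using additive_far_hom[OF shift_functor[of ?m] shift_additive[of ?m]] sh_m by metis
    from hom_Neg_eq_Zero_iff[OF hom_compose[OF this precomp_hom[OF x]] f1 T sh_ob[OF ob(2)]]
    show ?thesis
      using Hom_simps(3)[OF f] by (simp add: shift_add_ar)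
  qed
  then show ?thesis
    using dist_exact_shift[OF dist_rotate[OF dist_rotate[OF fgh]] h Neg_hom[OF f1] T, of ?m] sh_m
    by (auto simp: set_eq_iff)
qed

end

section \<open>The adjunction isomorphism on cohomology\<close>

lemma cohom_simps [simp]:
  "carrier (cohom C d A) = Hom C (unitO C) (sh C d A)"
  "\<one>\<^bsub>cohom C d A\<^esub> = Zero C (unitO C) (sh C d A)"
  by (simp_all add: cohom_def)

lemma (in tt_category) cohom_comm_group: "A \<in> Ob C \<Longrightarrow> comm_group (cohom C d A)"
  by (simp add: cohom_def hom_comm_group unitO_ob sh_ob)

context exact_functor begin

lemma fsh_hom: "A \<in> Ob C \<Longrightarrow> fsh F n A \<in> Hom D (fob F (sh C n A)) (sh D n (fob F A))"
  using natural_transD(1)[OF fsh_natural] by (simp add: comp_functor_def)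

lemma fsh_comp: "f \<in> Hom C A B \<Longrightarrow> fsh F n B \<cdot>\<^bsub>D\<^esub> far F (shm C n f) = shm D n (far F f) \<cdot>\<^bsub>D\<^esub> fsh F n A"
  using natural_transD(2)[OF fsh_natural] by (simp add: comp_functor_def)

end

context exact_adjunction begin

lemma unit_hom: "A \<in> Ob C \<Longrightarrow> \<eta> A \<in> Hom C A (fob G (fob F A))"
  using natural_transD(1)[OF unit_natural] by (simp add: comp_functor_def id_functor_def)

lemma counit_hom: "B \<in> Ob D \<Longrightarrow> \<epsilon> B \<in> Hom D (fob F (fob G B)) B"
  using natural_transD(1)[OF counit_natural] by (simp add: comp_functor_def id_functor_def)

text \<open>Composing with the bijection induced by G(B[n]) -> (G B)[n] turns this map into the
  ordinary transpose at B[n]: that is what \<open>counit_shift\<close> says. The composite and one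
  factor being bijective, so is the other factor.\<close>

lemma transpose_shift_bij:
  assumes T: "T \<in> Ob C" and B: "B \<in> Ob D"
  shows "bij_betw (\<lambda>x. shm D n (\<epsilon> B) \<cdot>\<^bsub>D\<^esub> (fsh F n (fob G B) \<cdot>\<^bsub>D\<^esub> far F x))
      (Hom C T (sh C n (fob G B))) (Hom D (fob F T) (sh D n B))"
    (is "bij_betw ?\<Psi> ?H ?K")
proof -
  have GB: "fob G B \<in> Ob C" by (rule G.fob_ob[OF B])
  let ?\<phi> = "fsh G n B"
  have \<phi>: "?\<phi> \<in> Hom C (fob G (sh D n B)) (sh C n (fob G B))" by (rule G.fsh_hom[OF B])
  note \<phi>_bij = F.C.postcomp_iso_bij[OF G.fsh_iso[OF B] \<phi>]
  let ?H' = "Hom C T (fob G (sh D n B))"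
  have "?\<Psi> (?\<phi> \<cdot>\<^bsub>C\<^esub> y) = \<epsilon> (sh D n B) \<cdot>\<^bsub>D\<^esub> far F y" if y: "y \<in> ?H'" for y
  proof -
    note e = F.D.shm_hom[OF counit_hom[OF B], of n]
    note fs = F.fsh_hom[OF GB, of n]
    note F\<phi> = F.far_hom[OF \<phi>] and Fy = F.far_hom[OF y]
    show ?thesis
      using F.far_comp[OF y \<phi>] F.D.comp_assoc[OF Fy F\<phi> fs] F.D.comp_assoc[OF Fy F.D.comp_hom[OF F\<phi> fs] e]
        F.D.comp_assoc[OF F\<phi> fs e] counit_shift[OF B, of n] by simp
  qed
  moreover have "bij_betw (\<lambda>y. \<epsilon> (sh D n B) \<cdot>\<^bsub>D\<^esub> far F y) ?H' ?K"
    by (rule transpose_bij[OF T F.D.sh_ob[OF B]])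
  ultimately have "bij_betw (?\<Psi> \<circ> (\<cdot>\<^bsub>C\<^esub>) ?\<phi>) ?H' ?K"
    by (subst bij_betw_cong) auto
  then show ?thesis using bij_betw_comp_iff[OF \<phi>_bij] by blast
qed

end

context coefficient_system begin

text \<open>Bijective as the translated transpose followed by precomposition with the isomorphism
  \<open>funit\<close>; a homomorphism because the functor is additive and composition is
  biadditive.\<close>

lemma adjunct_iso:
  assumes f: "f \<in> Hom (spaces K) X Y" and B: "B \<in> Ob (coeff K X)"
  shows "adjunct K f d B \<in> iso (cohom (coeff K Y) d (fob (push K f) B)) (cohom (coeff K X) d B)"
proof -
  let ?X = "coeff K X" and ?Y = "coeff K Y" and ?p = "pull K f" and ?B = "fob (push K f) B"
  interpret A: exact_adjunction ?Y ?X ?p "push K f" "un K f" "cn K f" by (rule pull_push[OF f])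
  interpret M: symmetric_monoidal_functor ?Y ?X ?p by (rule pull_monoidal[OF f])
  let ?T = "unitO ?Y" and ?u = "funit ?p"
  have B': "?B \<in> Ob ?Y" by (rule A.G.fob_ob[OF B])
  note e = A.F.D.shm_hom[OF A.counit_hom[OF B], of d] and s = A.F.fsh_hom[OF B', of d]
    and u = M.funit_hom
  \<comment> \<open>Moving \<open>?u\<close> to the outside separates the translated transpose from
    the precomposition with the unit isomorphism.\<close>
  have adj: "adjunct K f d B a = (shm ?X d (cn K f B) \<cdot>\<^bsub>?X\<^esub> (fsh ?p d ?B \<cdot>\<^bsub>?X\<^esub> far ?p a)) \<cdot>\<^bsub>?X\<^esub> ?u"
    if a: "a \<in> Hom ?Y ?T (sh ?Y d ?B)" for a
    using A.F.D.comp_assoc[OF u A.F.D.comp_hom[OF A.F.far_hom[OF a] s] e]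
    by (simp add: adjunct_def pullback_class_def Hom_simps[OF f] Let_def)
  have "bij_betw (adjunct K f d B) (Hom ?Y ?T (sh ?Y d ?B)) (Hom ?X (unitO ?X) (sh ?X d B))"
    using bij_betw_trans[OF A.transpose_shift_bij[OF M.C.unitO_ob B, of d] A.F.D.precomp_iso_bij[OF M.funit_iso u]]
    by (subst bij_betw_cong[OF adj]) (simp_all add: comp_def)
  moreover have "adjunct K f d B \<in> hom (cohom ?Y d ?B) (cohom ?X d B)"
  proof -
    have "(\<lambda>v. v \<cdot>\<^bsub>?X\<^esub> ?u) \<circ> ((\<cdot>\<^bsub>?X\<^esub>) (shm ?X d (cn K f B)) \<circ> ((\<cdot>\<^bsub>?X\<^esub>) (fsh ?p d ?B) \<circ> far ?p))
        \<in> hom (cohom ?Y d ?B) (cohom ?X d B)"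
      unfolding cohom_def
      by (rule hom_compose[OF hom_compose[OF hom_compose[OF
            additive_far_hom[OF A.F.cat_functor_axioms A.F.additive]
            A.F.D.postcomp_hom[OF s]] A.F.D.postcomp_hom[OF e]] A.F.D.precomp_hom[OF u]])
    \<comment> \<open>\<open>adj\<close> is established for arrows of the right type, so the
      homomorphism property is transferred by agreement on the carrier.\<close>
    then show ?thesis
      by (rule group.hom_restrict[rotated])
        (use adj A.F.C.hom_group_is_group[OF M.C.unitO_ob A.F.C.sh_ob[OF B']] in
          \<open>auto simp: cohom_def\<close>)
  qed
  ultimately show ?thesis by (simp add: iso_def)
qed

text \<open>Naturality of \<open>fsh\<close> at \<open>un K f A\<close> brings the pulled-back unit
  next to the counit, where the d-th translate of \<open>triangle_left\<close> cancels the two. This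
  matches restriction to the open part with the second map of the localisation triangle.\<close>

lemma adjunct_unit:
  assumes f: "f \<in> Hom (spaces K) X Y" and A: "A \<in> Ob (coeff K Y)"
    and c: "c \<in> carrier (cohom (coeff K Y) d A)"
  shows "adjunct K f d (fob (pull K f) A) (shm (coeff K Y) d (un K f A) \<cdot>\<^bsub>coeff K Y\<^esub> c)
    = pullback_class K f d A c"
proof -
  let ?X = "coeff K X" and ?Y = "coeff K Y" and ?p = "pull K f"
  let ?A = "fob ?p A"
  let ?B = "fob (push K f) ?A"
  interpret A: exact_adjunction ?Y ?X ?p "push K f" "un K f" "cn K f" by (rule pull_push[OF f])
  interpret M: symmetric_monoidal_functor ?Y ?X ?p by (rule pull_monoidal[OF f])
  let ?u = "funit ?p" and ?n = "un K f A"
  have A': "?A \<in> Ob ?X" by (rule A.F.fob_ob[OF A])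
  have B: "?B \<in> Ob ?Y" by (rule A.G.fob_ob[OF A'])
  have c: "c \<in> Hom ?Y (unitO ?Y) (sh ?Y d A)" using c by simp
  note u = M.funit_hom and n = A.unit_hom[OF A]
  note e = A.counit_hom[OF A']
  note ed = A.F.D.shm_hom[OF e, of d] and nd = A.F.C.shm_hom[OF n, of d]
  note s = A.F.fsh_hom[OF B, of d] and s' = A.F.fsh_hom[OF A, of d]
  note Fn = A.F.far_hom[OF n] and Fnd = A.F.far_hom[OF nd] and Fc = A.F.far_hom[OF c]
  note Fns = A.F.D.shm_hom[OF Fn, of d]
  have "shm ?X d (cn K f ?A) \<cdot>\<^bsub>?X\<^esub> (fsh ?p d ?B \<cdot>\<^bsub>?X\<^esub> far ?p (shm ?Y d ?n \<cdot>\<^bsub>?Y\<^esub> c))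
     = shm ?X d (cn K f ?A) \<cdot>\<^bsub>?X\<^esub> ((fsh ?p d ?B \<cdot>\<^bsub>?X\<^esub> far ?p (shm ?Y d ?n)) \<cdot>\<^bsub>?X\<^esub> far ?p c)"
    using A.F.far_comp[OF c nd] A.F.D.comp_assoc[OF Fc Fnd s] by simp
  also have "\<dots> = shm ?X d (cn K f ?A) \<cdot>\<^bsub>?X\<^esub> (shm ?X d (far ?p ?n) \<cdot>\<^bsub>?X\<^esub> (fsh ?p d A \<cdot>\<^bsub>?X\<^esub> far ?p c))"
    using A.F.fsh_comp[OF n, of d] A.F.D.comp_assoc[OF Fc s' Fns] by simp
  also have "\<dots> = shm ?X d (cn K f ?A \<cdot>\<^bsub>?X\<^esub> far ?p ?n) \<cdot>\<^bsub>?X\<^esub> (fsh ?p d A \<cdot>\<^bsub>?X\<^esub> far ?p c)"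
    using A.F.D.comp_assoc[OF A.F.D.comp_hom[OF Fc s'] Fns ed] A.F.D.shm_comp[OF Fn e] by simp
  also have "\<dots> = fsh ?p d A \<cdot>\<^bsub>?X\<^esub> far ?p c"
    using A.triangle_left[OF A] cat_functor.far_id[OF A.F.D.shift_functor A', of d]
      A.F.D.id_left[OF A.F.D.comp_hom[OF Fc s']] by simp
  finally show ?thesis
    using A.F.D.comp_assoc[OF u A.F.D.comp_hom[OF A.F.far_hom[OF A.F.C.comp_hom[OF c nd]] s] ed]
    by (simp add: adjunct_def pullback_class_def Hom_simps[OF f] Let_def)
qed

end

section \<open>Torsors\<close>

text \<open>Left translation by \<open>N\<close> permutes the right coset of \<open>s\<close> simply
  transitively, and an injective homomorphism transports this. The form with \<Phi> serves twice:
  with the identity for the lifts, and with the adjunction isomorphism for the localised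
  classes.\<close>

lemma torsor_coset:
  assumes G: "group G" and L: "group L" and \<Phi>: "\<Phi> \<in> hom G L" "inj_on \<Phi> (carrier G)"
    and N: "subgroup N G" and s: "s \<in> carrier G"
  defines "S \<equiv> \<Phi> ` (N #>\<^bsub>G\<^esub> s)"
  shows "torsor (G\<lparr>carrier := N\<rparr>) S (\<lambda>g. \<lambda>l \<in> S. \<Phi> g \<otimes>\<^bsub>L\<^esub> l)"
proof -
  interpret G: group G by (rule G)
  interpret L: group L by (rule L)
  interpret N: subgroup N G by (rule N)
  interpret \<Phi>: group_hom G L \<Phi>
    using \<Phi> by unfold_locales
  let ?N = "G\<lparr>carrier := N\<rparr>" and ?a = "\<lambda>g. \<lambda>l \<in> S. \<Phi> g \<otimes>\<^bsub>L\<^esub> l"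
  interpret NG: group ?N by (rule N.subgroup_is_group[OF G])
  have S: "S = (\<lambda>n. \<Phi> n \<otimes>\<^bsub>L\<^esub> \<Phi> s) ` N"
    unfolding S_def r_coset_def using s N.subset by (auto simp: image_iff)
  have S_carrier: "l \<in> carrier L" if "l \<in> S" for l
    using that s by (auto simp: S)
  have closed: "\<Phi> g \<otimes>\<^bsub>L\<^esub> l \<in> S" if g: "g \<in> N" and l: "l \<in> S" for g l
  proof -
    obtain n where n: "n \<in> N" "l = \<Phi> n \<otimes>\<^bsub>L\<^esub> \<Phi> s" using l by (auto simp: S)
    then have "\<Phi> g \<otimes>\<^bsub>L\<^esub> l = \<Phi> (g \<otimes>\<^bsub>G\<^esub> n) \<otimes>\<^bsub>L\<^esub> \<Phi> s"
      using g s by (simp add: L.m_assoc)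
    then show ?thesis using N.m_closed[OF g n(1)] by (auto simp: S)
  qed
  \<comment> \<open>\<open>Bij S\<close> consists of extensional functions, whence the restricted
    abstraction in \<open>?a\<close>. The inverse is translation by the inverse of
    \<open>g\<close>.\<close>
  have bij: "?a g \<in> Bij S" if g: "g \<in> N" for g
  proof -
    have "bij_betw (\<lambda>l. \<Phi> g \<otimes>\<^bsub>L\<^esub> l) S S"
    proof (rule bij_betw_byWitness[where f' = "\<lambda>l. \<Phi> (inv\<^bsub>G\<^esub> g) \<otimes>\<^bsub>L\<^esub> l"])
      show "\<forall>l\<in>S. \<Phi> (inv\<^bsub>G\<^esub> g) \<otimes>\<^bsub>L\<^esub> (\<Phi> g \<otimes>\<^bsub>L\<^esub> l) = l"
        using g S_carrier by (simp add: L.m_assoc[symmetric])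
      show "\<forall>l\<in>S. \<Phi> g \<otimes>\<^bsub>L\<^esub> (\<Phi> (inv\<^bsub>G\<^esub> g) \<otimes>\<^bsub>L\<^esub> l) = l"
        using g S_carrier by (simp add: L.m_assoc[symmetric])
    qed (use closed g N.m_inv_closed in \<open>auto simp del: \<Phi>.hom_inv\<close>)
    then show ?thesis by (auto simp: Bij_def cong: bij_betw_cong)
  qed
  have "?a \<in> hom ?N (BijGroup S)"
  proof (rule homI)
    fix g g' assume gs: "g \<in> carrier ?N" "g' \<in> carrier ?N"
    have "?a (g \<otimes>\<^bsub>G\<^esub> g') = compose S (?a g) (?a g')"
      using gs closed S_carrier by (auto simp: compose_def restrict_def L.m_assoc fun_eq_iff)
    then show "?a (g \<otimes>\<^bsub>?N\<^esub> g') = ?a g \<otimes>\<^bsub>BijGroup S\<^esub> ?a g'"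
      using gs bij by (simp add: BijGroup_def)
  qed (use bij in \<open>auto simp: BijGroup_def\<close>)
  then have act: "group_action ?N S ?a"
    using NG.group_axioms group_BijGroup
    by (simp add: group_action_def group_hom_def group_hom_axioms_def)
  have "\<exists>g\<in>N. ?a g x = y" if "x \<in> S" "y \<in> S" for x y
  proof -
    obtain m n where m: "m \<in> N" "x = \<Phi> m \<otimes>\<^bsub>L\<^esub> \<Phi> s" and n: "n \<in> N" "y = \<Phi> n \<otimes>\<^bsub>L\<^esub> \<Phi> s"
      using \<open>x \<in> S\<close> \<open>y \<in> S\<close> by (auto simp: S)
    \<comment> \<open>Transitivity: n m^{-1} carries the point given by \<open>m\<close> to the one
      given by \<open>n\<close>.\<close>
    have "\<Phi> (n \<otimes>\<^bsub>G\<^esub> inv\<^bsub>G\<^esub> m) \<otimes>\<^bsub>L\<^esub> x = \<Phi> (n \<otimes>\<^bsub>G\<^esub> inv\<^bsub>G\<^esub> m \<otimes>\<^bsub>G\<^esub> (m \<otimes>\<^bsub>G\<^esub> s))"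
      using m n s by simp
    also have "\<dots> = y" using m n s by (simp add: L.m_assoc L.inv_solve_left')
    finally show ?thesis
      using that m n by (intro bexI[of _ "n \<otimes>\<^bsub>G\<^esub> inv\<^bsub>G\<^esub> m"]) auto
  qed
  then have "transitive_action ?N S ?a"
    using act by (simp add: transitive_action_def transitive_action_axioms_def)
  moreover have "S \<noteq> {}" using N.one_closed unfolding S by blast
  moreover have "stabilizer ?N ?a x = {\<one>\<^bsub>?N\<^esub>}" if x: "x \<in> S" for x
  proof -
    have "g = \<one>\<^bsub>G\<^esub>" if "g \<in> N" "\<Phi> g \<otimes>\<^bsub>L\<^esub> x = x" for g
    proof -
      \<comment> \<open>Freeness: cancel \<open>x\<close> in \<open>L\<close>, then use injectivity
        of \<Phi>.\<close>
      have "\<Phi> g = \<Phi> \<one>\<^bsub>G\<^esub>"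
        using that S_carrier[OF x] by (simp add: L.l_cancel_one)
      then show ?thesis using \<Phi>(2) that by (simp add: inj_on_def)
    qed
    then show ?thesis
      using x S_carrier[OF x] N.one_closed by (auto simp: stabilizer_def)
  qed
  ultimately show ?thesis by (simp add: torsor_def)
qed

text \<open>x = (x s^{-1}) s, and x s^{-1} lies in the kernel when x and s have the same image. A
  single lift thus presents all lifts in the form taken by \<open>torsor_coset\<close>.\<close>

lemma (in group_hom) fibre_eq_coset:
  assumes "s \<in> carrier G"
  shows "{x \<in> carrier G. h x = h s} = kernel G H h #> s"
proof (intro equalityI subsetI)
  fix x assume x: "x \<in> {x \<in> carrier G. h x = h s}"
  then have "x \<otimes> inv s \<in> kernel G H h" "x = x \<otimes> inv s \<otimes> s"
    using assms by (simp_all add: kernel_def G.m_assoc)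
  then show "x \<in> kernel G H h #> s" unfolding r_coset_def by blast
qed (use assms in \<open>auto simp: r_coset_def kernel_def\<close>)

text \<open>Classes with support take values in (i_* i^! A)[d], while the counit at A[d] starts at
  i_* i^!(A[d]); \<open>shift_ident\<close> bridges the two in the last clause. There
  \<open>inv_into (carrier HZ) \<Phi>\<close> passes from a map out of the unit on Z to its adjoint,
  and the equivalence packs existence and uniqueness together.\<close>

theorem theorem4p11:
  fixes K :: "('s, 'f, 'o, 'm) coeff_system" and R :: "('o, 'm) recollement_data"
    and i j :: 'f and X Z U :: 's and A :: 'o and c :: 'm and d :: int
  assumes "coefficient_system K"
    and "i \<in> Hom (spaces K) Z X" and "j \<in> Hom (spaces K) U X"
    and "i \<in> closed_imm K" and "(i, j) \<in> open_compl K"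
    and "recollement K i j R"
    and "A \<in> Ob (coeff K X)"
    and "c \<in> carrier (cohom (coeff K X) d A)"
    and "pullback_class K j d A c = \<one>\<^bsub>cohom (coeff K U) d (fob (pull K j) A)\<^esub>"
  defines "HZ \<equiv> cohom_supp K i R d A"
    and "im\<delta> \<equiv> im_connecting K i j R (d - 1) A"
    and "\<Phi> \<equiv> loc_adj K i R d A"
    and "LG \<equiv> loc_group K i R d A"
    and "LiftS \<equiv> Lift K i R d A c"
    and "LocS \<equiv> Loc_tor K i R d A c"
  shows
    "subgroup im\<delta> HZ \<and>
     torsor (HZ\<lparr>carrier := im\<delta>\<rparr>) LiftS (\<lambda>g. \<lambda>s \<in> LiftS. g \<otimes>\<^bsub>HZ\<^esub> s) \<and>
     \<Phi> \<in> iso HZ LG \<and>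
     bij_betw \<Phi> LiftS LocS \<and>
     torsor (HZ\<lparr>carrier := im\<delta>\<rparr>) LocS (\<lambda>g. \<lambda>l \<in> LocS. \<Phi> g \<otimes>\<^bsub>LG\<^esub> l) \<and>
     (im\<delta> = {\<one>\<^bsub>HZ\<^esub>} \<longleftrightarrow>
        kernel HZ (cohom (coeff K X) d A) (forg K i R d A) = {\<one>\<^bsub>HZ\<^esub>}) \<and>
     (im\<delta> = {\<one>\<^bsub>HZ\<^esub>} \<longrightarrow>
        LocS = {Loc K i R d A c} \<and>
        (\<forall>l. l \<in> Hom (coeff K Z) (unitO (coeff K Z)) (sh (coeff K Z) d (fob (upper_shriek R) A)) \<and>
             shriek_cn_i R (sh (coeff K X) d A) \<cdot>\<^bsub>coeff K X\<^esub>
               (shift_ident K i R d A \<cdot>\<^bsub>coeff K X\<^esub> inv_into (carrier HZ) \<Phi> l) = c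
           \<longleftrightarrow> l = Loc K i R d A c))"
proof -

  \<comment> \<open>Setting: the categories, the adjunctions and the localisation triangle\<close>
  let ?X = "coeff K X" and ?Z = "coeff K Z" and ?U = "coeff K U"
  let ?E = "i_shriek_i K i R A" and ?A = "fob (pull K j) A" and ?iA = "fob (upper_shriek R) A"
  let ?B = "fob (push K j) ?A" and ?T = "unitO ?X" and ?forg = "forg K i R d A"
  let ?H = "cohom ?X d A"
  note spaces = Hom_simps(1,2)[OF assms(2)] Hom_simps(1)[OF assms(3)]
  note A = assms(7)
  interpret K: coefficient_system K by fact
  interpret X: tt_category ?X
    using K.coeff_tt category.Hom_Ob(2)[OF K.spaces_category assms(2)] .
  interpret Z: tt_category ?Z
    using K.coeff_tt category.Hom_Ob(1)[OF K.spaces_category assms(2)] .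
  interpret U: tt_category ?U
    using K.coeff_tt category.Hom_Ob(1)[OF K.spaces_category assms(3)] .
  interpret I: exact_adjunction ?Z ?X "push K i" "upper_shriek R" "shriek_un_i R" "shriek_cn_i R"
    using recollement.i_shriek_adj[OF assms(6)] by (simp add: spaces)
  interpret J: exact_adjunction ?X ?U "pull K j" "push K j" "un K j" "cn K j"
    by (rule K.pull_push[OF assms(3)])
  have T: "?T \<in> Ob ?X" by (rule X.unitO_ob)
  have iA: "?iA \<in> Ob ?Z" by (rule I.G.fob_ob[OF A])
  have jA: "?A \<in> Ob ?U" by (rule J.F.fob_ob[OF A])
  have E: "?E \<in> Ob ?X" unfolding i_shriek_i_def by (rule I.F.fob_ob[OF iA])
  have e: "shriek_cn_i R A \<in> Hom ?X ?E A" unfolding i_shriek_i_def by (rule I.counit_hom[OF A])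
  have n: "un K j A \<in> Hom ?X A ?B" by (rule J.unit_hom[OF A])
  have tri: "(shriek_cn_i R A, un K j A, bd_j R A) \<in> Dist ?X"
    using recollement.localisation_triangle[OF assms(6)] A by (simp add: spaces)
  have HZ: "HZ = cohom ?X d ?E" by (simp add: HZ_def cohom_supp_def spaces)
  have forg: "?forg = (\<cdot>\<^bsub>?X\<^esub>) (shm ?X d (shriek_cn_i R A))"
    by (simp add: forg_def spaces fun_eq_iff Let_def)
  have c: "c \<in> Hom ?X ?T (sh ?X d A)" using assms(8) by simp
  have gHZ: "group HZ" and gH: "group ?H"
    using X.cohom_comm_group E A by (simp_all add: HZ comm_group_def)
  interpret F: group_hom HZ ?H ?forg
    using gHZ gH X.postcomp_hom[OF X.shm_hom[OF e, of d], of ?T]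
    by (simp add: group_hom_def group_hom_axioms_def HZ cohom_def forg)

  \<comment> \<open>The image of the connecting morphism as a kernel\<close>
  have "im\<delta> = (\<cdot>\<^bsub>?X\<^esub>) (shm ?X (d - 1) (bd_j R A)) ` Hom ?X ?T (sh ?X (d - 1) ?B)"
  proof -
    \<comment> \<open>\<open>connecting\<close> begins with the inverse of \<open>adjunct\<close>,
      whose values exhaust the maps from the unit to (j_* j^* A)[d-1]. So its image is that of
      composition with the translate of \<open>bd_j R A\<close>.\<close>
    have "adjunct K j (d - 1) ?A \<in> iso (cohom ?X (d - 1) ?B) (cohom ?U (d - 1) ?A)"
      by (rule K.adjunct_iso[OF assms(3) jA])
    then have "inv_into (carrier (cohom ?X (d - 1) ?B)) (adjunct K j (d - 1) ?A) `
        carrier (cohom ?U (d - 1) ?A) = carrier (cohom ?X (d - 1) ?B)"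
      by (intro bij_betw_imp_surj_on bij_betw_inv_into) (simp add: iso_def)
    then have "(\<cdot>\<^bsub>?X\<^esub>) (shm ?X (d - 1) (bd_j R A)) ` (inv_into (carrier (cohom ?X (d - 1) ?B))
        (adjunct K j (d - 1) ?A) ` carrier (cohom ?U (d - 1) ?A))
      = (\<cdot>\<^bsub>?X\<^esub>) (shm ?X (d - 1) (bd_j R A)) ` Hom ?X ?T (sh ?X (d - 1) ?B)"
      by simp
    then show ?thesis
      by (simp add: im\<delta>_def im_connecting_def connecting_def spaces Let_def image_image)
  qed
  \<comment> \<open>Exactness at \<open>?E\<close>[d]. The degree is d - 1 because
    \<open>bd_j R A\<close> translated by d - 1 ends in \<open>?E\<close>[1][d-1] =
    \<open>?E\<close>[d].\<close>
  also have "\<dots> = {x \<in> Hom ?X ?T (sh ?X d ?E). ?forg x = Zero ?X ?T (sh ?X d A)}"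
    unfolding forg by (rule X.dist_exact_shift_third[OF tri e n T, symmetric])
  also have "\<dots> = kernel HZ ?H ?forg" by (simp add: kernel_def HZ)
  finally have im: "im\<delta> = kernel HZ ?H ?forg" .
  have sub: "subgroup im\<delta> HZ" unfolding im by (rule F.subgroup_kernel)

  \<comment> \<open>Existence of a lift\<close>
  obtain s where s: "s \<in> carrier HZ" "?forg s = c"
  proof -
    let ?nc = "shm ?X d (un K j A) \<cdot>\<^bsub>?X\<^esub> c"
    have nc: "?nc \<in> carrier (cohom ?X d ?B)" using X.comp_hom[OF c X.shm_hom[OF n]] by simp
    have B: "?B \<in> Ob ?X" by (rule J.G.fob_ob[OF jA])
    have iso: "adjunct K j d ?A \<in> iso (cohom ?X d ?B) (cohom ?U d ?A)"
      by (rule K.adjunct_iso[OF assms(3) jA])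
    interpret J': group_hom "cohom ?X d ?B" "cohom ?U d ?A" "adjunct K j d ?A"
      using X.cohom_comm_group[OF B] U.cohom_comm_group[OF jA] iso
      by (simp add: group_hom_def group_hom_axioms_def iso_def comm_group_def)
    \<comment> \<open>\<open>adjunct_unit\<close> identifies this value with the restriction of
      \<open>c\<close> to U, which is zero by assumption; injectivity of \<open>adjunct\<close> then
      kills \<open>?nc\<close> itself.\<close>
    have "adjunct K j d ?A ?nc = \<one>\<^bsub>cohom ?U d ?A\<^esub>"
      using K.adjunct_unit[OF assms(3) A assms(8)] assms(9) by simp
    then have "adjunct K j d ?A ?nc = adjunct K j d ?A \<one>\<^bsub>cohom ?X d ?B\<^esub>"
      using J'.hom_one by simp
    moreover have "inj_on (adjunct K j d ?A) (carrier (cohom ?X d ?B))"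
      using iso by (simp add: iso_def bij_betw_def)
    ultimately have "?nc = Zero ?X ?T (sh ?X d ?B)"
      using inj_onD[OF _ _ nc J'.G.one_closed] by simp
    \<comment> \<open>Exactness at the middle term A[d]: what the unit A -> j_* j^* A kills comes
      from \<open>?E\<close>[d].\<close>
    then have "c \<in> ?forg ` carrier HZ"
      using X.dist_exact_shift[OF tri e n T, of d] c by (auto simp: forg HZ)
    then show thesis using that by blast
  qed

  \<comment> \<open>Lifts and localised classes as torsors\<close>
  have LiftS: "LiftS = im\<delta> #>\<^bsub>HZ\<^esub> s"
    using F.fibre_eq_coset[OF s(1)] s(2) unfolding LiftS_def Lift_def HZ_def[symmetric] im by simp
  have LocS: "LocS = \<Phi> ` LiftS"
    by (simp add: LocS_def Loc_tor_def \<Phi>_def LiftS_def)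

  have iso: "\<Phi> \<in> iso HZ LG"
    using K.adjunct_iso[OF assms(2) iA, of d]
    by (simp add: \<Phi>_def loc_adj_def HZ LG_def loc_group_def i_shriek_i_def spaces)
  have LG: "LG = cohom ?Z d ?iA" by (simp add: LG_def loc_group_def spaces)
  have gLG: "group LG"
    using Z.cohom_comm_group[OF iA] by (simp add: LG comm_group_def)
  have \<Phi>: "\<Phi> \<in> hom HZ LG" "inj_on \<Phi> (carrier HZ)" "bij_betw \<Phi> (carrier HZ) (carrier LG)"
    using iso by (auto simp: iso_def bij_betw_def)
  have "LiftS \<subseteq> carrier HZ" by (auto simp: LiftS_def Lift_def HZ_def)
  then have bij: "bij_betw \<Phi> LiftS LocS"
    unfolding LocS by (rule inj_on_imp_bij_betw[OF inj_on_subset[OF \<Phi>(2)]])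
  have tor: "torsor (HZ\<lparr>carrier := im\<delta>\<rparr>) LiftS (\<lambda>g. \<lambda>s \<in> LiftS. g \<otimes>\<^bsub>HZ\<^esub> s)"
    using torsor_coset[OF gHZ gHZ _ _ sub s(1), of "\<lambda>x. x"] by (simp add: LiftS hom_def)
  have tor': "torsor (HZ\<lparr>carrier := im\<delta>\<rparr>) LocS (\<lambda>g. \<lambda>l \<in> LocS. \<Phi> g \<otimes>\<^bsub>LG\<^esub> l)"
    using torsor_coset[OF gHZ gLG \<Phi>(1,2) sub s(1)] by (simp add: LocS LiftS)

  \<comment> \<open>The counit at A[d] and the forgetful map\<close>
  have counit: "shriek_cn_i R (sh ?X d A) \<cdot>\<^bsub>?X\<^esub> (shift_ident K i R d A \<cdot>\<^bsub>?X\<^esub> x) = ?forg x"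
    if x: "x \<in> carrier HZ" for x
  proof -
    \<comment> \<open>The comparison from i_* i^!(A[d]) to (i_* i^! A)[d], an isomorphism since
      \<open>push K i\<close> preserves isomorphisms; \<open>shift_ident\<close> is its
      inverse.\<close>
    let ?q = "fsh (push K i) d ?iA \<cdot>\<^bsub>?X\<^esub> far (push K i) (fsh (upper_shriek R) d A)"
    note g = I.G.fsh_hom[OF A, of d]
    note ig = I.F.far_hom[OF g] and p = I.F.fsh_hom[OF iA, of d]
    note q = X.comp_hom[OF ig p]
    have "is_iso ?X ?q"
      by (rule X.is_iso_comp[OF ig I.F.far_iso[OF g I.G.fsh_iso[OF A]] p I.F.fsh_iso[OF iA]])
    note q' = X.inverse_arrow[OF this q]
    have e': "shm ?X d (shriek_cn_i R A) \<in> Hom ?X (sh ?X d (fob (push K i) ?iA)) (sh ?X d A)"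
      using X.shm_hom[OF e] by (simp add: i_shriek_i_def)
    have x: "x \<in> Hom ?X ?T (sh ?X d (fob (push K i) ?iA))" using x by (simp add: HZ i_shriek_i_def)
    \<comment> \<open>\<open>counit_shift\<close> factors the counit at A[d] through
      \<open>?q\<close>, so \<open>shift_ident\<close> cancels and the map defining
      \<open>forg\<close> remains.\<close>
    have "shriek_cn_i R (sh ?X d A) = shm ?X d (shriek_cn_i R A) \<cdot>\<^bsub>?X\<^esub> ?q"
      using I.counit_shift[OF A, of d] X.comp_assoc[OF ig p e'] by simp
    moreover have "shift_ident K i R d A = inverse_arrow ?X ?q"
      by (simp add: shift_ident_def spaces Let_def)
    ultimately show ?thesis
      using X.comp_assoc[OF X.comp_hom[OF x q'(1)] q e'] X.comp_assoc[OF x q'(1) q] q'(3)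
        X.id_left[OF x] by (simp add: forg)
  qed

  \<comment> \<open>The canonical class when the connecting morphism has trivial image\<close>
  have "LocS = {Loc K i R d A c} \<and>
        (\<forall>l. l \<in> Hom ?Z (unitO ?Z) (sh ?Z d ?iA) \<and>
             shriek_cn_i R (sh ?X d A) \<cdot>\<^bsub>?X\<^esub>
               (shift_ident K i R d A \<cdot>\<^bsub>?X\<^esub> inv_into (carrier HZ) \<Phi> l) = c
           \<longleftrightarrow> l = Loc K i R d A c)" if "im\<delta> = {\<one>\<^bsub>HZ\<^esub>}"
  proof -
    have Lift_s: "LiftS = {s}" using that s(1) by (simp add: LiftS r_coset_def)
    then have Loc_s: "LocS = {\<Phi> s}" by (simp add: LocS)
    then have Loc: "Loc K i R d A c = \<Phi> s" by (simp add: Loc_def LocS_def)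
    \<comment> \<open>Under the bijection \<Phi>, the condition says that the adjoint of
      \<open>l\<close> is a lift, and \<open>s\<close> is the only one.\<close>
    have "l \<in> carrier LG \<and> ?forg (inv_into (carrier HZ) \<Phi> l) = c \<longleftrightarrow> l = \<Phi> s" for l
    proof
      assume l: "l \<in> carrier LG \<and> ?forg (inv_into (carrier HZ) \<Phi> l) = c"
      then have "inv_into (carrier HZ) \<Phi> l \<in> LiftS"
        using bij_betwE[OF bij_betw_inv_into[OF \<Phi>(3)]] by (auto simp: LiftS_def Lift_def HZ_def)
      then show "l = \<Phi> s" using bij_betw_inv_into_right[OF \<Phi>(3)] l Lift_s by auto
    next
      assume "l = \<Phi> s"
      then show "l \<in> carrier LG \<and> ?forg (inv_into (carrier HZ) \<Phi> l) = c"
        using bij_betw_inv_into_left[OF \<Phi>(3)] bij_betwE[OF \<Phi>(3)] s by simp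
    qed
    \<comment> \<open>\<open>counit\<close> holds on \<open>carrier HZ\<close>, and
      \<open>inv_into\<close> is sure to land there only for arguments in the range of
      \<Phi>.\<close>
    moreover have "inv_into (carrier HZ) \<Phi> l \<in> carrier HZ" if "l \<in> carrier LG" for l
      using bij_betwE[OF bij_betw_inv_into[OF \<Phi>(3)]] that by blast
    ultimately have "l \<in> carrier LG \<and> shriek_cn_i R (sh ?X d A) \<cdot>\<^bsub>?X\<^esub>
        (shift_ident K i R d A \<cdot>\<^bsub>?X\<^esub> inv_into (carrier HZ) \<Phi> l) = c \<longleftrightarrow> l = \<Phi> s" for l
      using counit by metis
    then show ?thesis unfolding Loc Loc_s by (simp add: LG)
  qed
  \<comment> \<open>The equivalence of the two vanishing conditions is immediate from
    \<open>im\<close>, which equates the image with the kernel.\<close>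
  then show ?thesis using sub tor iso bij tor' im by simp
qed

end
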